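(* Let $P$, $Q$ be finite posets. Then $L(P,Q)$ is unmixed if and only if one of the following conditions holds: (a) Both $P$ and $Q$ are rooted. (b) Both $P$ and $Q$ are co-rooted. (c) $P$ or $Q$ is a disjoint union of chains. Moreover, if $P$ or $Q$ is connected and $L(P,Q)$ is unmixed, then $L(P,Q)^\vee=L(Q,P)^\tau$.
   Context: All posets are finite and nonempty; $\mathbb{K}$ is an arbitrary field. $\operatorname{Hom}(P,Q)$ is the set of order-preserving maps $P\to Q$. $S_{P,Q}=\mathbb{K}[x_{p,q} : p\in P, q\in Q]$, $u_\phi=\prod_{p\in P}x_{p,\phi(p)}$, and $L(P,Q)=(u_\phi : \phi\in \operatorname{Hom}(P,Q))\subseteq S_{P,Q}$. $L(Q,P)^\tau\subseteq S_{P,Q}$ is obtained from $L(Q,P)\subseteq S_{Q,P}$ by switching the indices of the variables, $x_{q,p}\mapsto x_{p,q}$. For a squarefree monomial ideal $I$, the Alexander dual $I^\vee$ is the ideal generated by the monomials $\prod_{x\in \mathfrak p} x$ (product over the variables in $\mathfrak p$), where $\mathfrak p$ ranges over the minimal primes of $I$. An ideal is unmixed if all its associated primes have the same height. A poset $P$ is rooted if for any two incomparable $p_1,p_2\in P$ there is no $p\in P$ with $p>p_1,p_2$; it is co-rooted if for any two incomparable $p_1,p_2\in P$ there is no $p\in P$ with $p<p_1,p_2$. A poset is connected if its Hasse diagram is connected as a graph; it is a disjoint union of chains if each connected component is totally ordered. *)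

theory Defs
  imports
    "HOL-Library.Poly_Mapping"
    "HOL-Library.Extended_Nat"
    "HOL-Algebra.Ideal"
    "HOL-Algebra.Algebraic_Closure_Type"
begin

section \<open>Finite posets\<close>

text \<open>
  A finite nonempty poset is a type of sort \<open>{finite, order}\<close>; poset properties are predicates
  on \<open>TYPE('p)\<close>.
\<close>

definition incomparable :: "'p::order \<Rightarrow> 'p \<Rightarrow> bool" where
  "incomparable x y \<longleftrightarrow> \<not> x \<le> y \<and> \<not> y \<le> x"

definition rooted :: "'p::order itself \<Rightarrow> bool" where
  "rooted (_ :: 'p itself) \<longleftrightarrow>
     (\<forall>p1 p2 :: 'p. incomparable p1 p2 \<longrightarrow> \<not> (\<exists>p. p1 < p \<and> p2 < p))"

definition co_rooted :: "'p::order itself \<Rightarrow> bool" where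
  "co_rooted (_ :: 'p itself) \<longleftrightarrow>
     (\<forall>p1 p2 :: 'p. incomparable p1 p2 \<longrightarrow> \<not> (\<exists>p. p < p1 \<and> p < p2))"

definition covered_by :: "'p::order \<Rightarrow> 'p \<Rightarrow> bool" where
  "covered_by x y \<longleftrightarrow> x < y \<and> \<not> (\<exists>z. x < z \<and> z < y)"

definition hasse_adjacent :: "'p::order \<Rightarrow> 'p \<Rightarrow> bool" where
  "hasse_adjacent x y \<longleftrightarrow> covered_by x y \<or> covered_by y x"

definition hasse_component :: "'p::order \<Rightarrow> 'p set" where
  "hasse_component x = {y. hasse_adjacent\<^sup>*\<^sup>* x y}"

definition connected_poset :: "'p::order itself \<Rightarrow> bool" where
  "connected_poset (_ :: 'p itself) \<longleftrightarrow> (\<forall>x :: 'p. hasse_component x = UNIV)"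

definition disjoint_union_of_chains :: "'p::order itself \<Rightarrow> bool" where
  "disjoint_union_of_chains (_ :: 'p itself) \<longleftrightarrow>
     (\<forall>z :: 'p. \<forall>x\<in>hasse_component z. \<forall>y\<in>hasse_component z. x \<le> y \<or> y \<le> x)"

section \<open>Primes, heights and unmixed ideals in a commutative ring\<close>

definition minimal_primes :: "('a, 'b) ring_scheme \<Rightarrow> 'a set \<Rightarrow> 'a set set" where
  "minimal_primes R I =
     {\<pp>. primeideal \<pp> R \<and> I \<subseteq> \<pp> \<and> \<not> (\<exists>\<qq>. primeideal \<qq> R \<and> I \<subseteq> \<qq> \<and> \<qq> \<subset> \<pp>)}"

text \<open>
  As usual for ideals, the associated primes of \<open>I\<close> are those of the module \<open>R/I\<close>, i.e. the primes
  that are annihilators of residue classes \<open>f + I\<close>.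
\<close>

definition associated_primes :: "('a, 'b) ring_scheme \<Rightarrow> 'a set \<Rightarrow> 'a set set" where
  "associated_primes R I =
     {\<pp>. primeideal \<pp> R \<and> (\<exists>f\<in>carrier R. \<pp> = {g \<in> carrier R. g \<otimes>\<^bsub>R\<^esub> f \<in> I})}"

text \<open>The height of a prime ideal: the supremum of the lengths \<open>n\<close> of chains of primes
  \<open>c 0 \<subset> \<dots> \<subset> c n = \<pp>\<close>.\<close>

definition prime_height :: "('a, 'b) ring_scheme \<Rightarrow> 'a set \<Rightarrow> enat" where
  "prime_height R \<pp> =
     Sup {enat n | n. \<exists>c :: nat \<Rightarrow> 'a set.
            (\<forall>i\<le>n. primeideal (c i) R) \<and> (\<forall>i<n. c i \<subset> c (Suc i)) \<and> c n = \<pp>}"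

definition unmixed :: "('a, 'b) ring_scheme \<Rightarrow> 'a set \<Rightarrow> bool" where
  "unmixed R I \<longleftrightarrow>
     (\<forall>\<pp>\<in>associated_primes R I. \<forall>\<qq>\<in>associated_primes R I. prime_height R \<pp> = prime_height R \<qq>)"

section \<open>Polynomial rings and Alexander duality\<close>

text \<open>
  Polynomials with variables indexed by \<open>'v\<close>: a monomial is its finitely supported exponent
  vector, a polynomial is its finitely supported coefficient function.  The polynomial ring as an
  object of HOL-Algebra is \<^const>\<open>ring_of_type_algebra\<close>, whose carrier is the whole type.
\<close>

type_synonym ('v, 'k) mpoly = "('v \<Rightarrow>\<^sub>0 nat) \<Rightarrow>\<^sub>0 'k"

definition var :: "'v \<Rightarrow> ('v, 'k::field) mpoly" where
  "var v = Poly_Mapping.single (Poly_Mapping.single v 1) 1"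

definition alexander_dual :: "('v::finite, 'k::field) mpoly set \<Rightarrow> ('v, 'k) mpoly set" where
  "alexander_dual I =
     genideal ring_of_type_algebra
       {(\<Prod>v\<in>{v. var v \<in> \<pp>}. var v) | \<pp>. \<pp> \<in> minimal_primes ring_of_type_algebra I}"

section \<open>Ideals of poset homomorphisms\<close>

definition hom_monomial :: "('p::finite \<Rightarrow> 'q) \<Rightarrow> ('p \<times> 'q, 'k::field) mpoly" where
  "hom_monomial \<phi> = (\<Prod>p\<in>UNIV. var (p, \<phi> p))"

definition hom_ideal ::
  "'p::{finite,order} itself \<Rightarrow> 'q::{finite,order} itself \<Rightarrow> 'k::field itself \<Rightarrow>
     ('p \<times> 'q, 'k) mpoly set" where
  "hom_ideal (_ :: 'p itself) (_ :: 'q itself) (_ :: 'k itself) =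
     genideal ring_of_type_algebra {hom_monomial \<phi> | \<phi> :: 'p \<Rightarrow> 'q. mono \<phi>}"

text \<open>
  The renaming of variables: the coefficient of \<open>swap_indices f\<close> at a monomial \<open>m\<close> is the
  coefficient of \<open>f\<close> at \<open>m\<close> with all index pairs swapped.  The lemmas below confirm that this is the
  \<open>K\<close>-algebra homomorphism determined by its values on the variables.
\<close>

definition swap_indices :: "('q \<times> 'p, 'k::field) mpoly \<Rightarrow> ('p \<times> 'q, 'k) mpoly" where
  "swap_indices f = Poly_Mapping.map_key (Poly_Mapping.map_key prod.swap) f"

lemma map_key_swap_swap [simp]:
  "Poly_Mapping.map_key prod.swap (Poly_Mapping.map_key prod.swap m) = m"
  for m :: "('a \<times> 'b) \<Rightarrow>\<^sub>0 nat"
  by (rule poly_mapping_eqI) (simp add: map_key.rep_eq)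

lemma inj_map_key_swap:
  "inj (Poly_Mapping.map_key prod.swap :: (('a \<times> 'b) \<Rightarrow>\<^sub>0 nat) \<Rightarrow> (('b \<times> 'a) \<Rightarrow>\<^sub>0 nat))"
  by (rule inj_on_inverseI[of _ "Poly_Mapping.map_key prod.swap"]) simp

lemma swap_indices_single:
  "swap_indices (Poly_Mapping.single m c) =
     Poly_Mapping.single (Poly_Mapping.map_key prod.swap m) c"
  unfolding swap_indices_def
  using map_key_single[OF inj_map_key_swap, of "Poly_Mapping.map_key prod.swap m" c] by simp

lemma swap_indices_var: "swap_indices (var (q, p)) = var (p, q)"
proof -
  have "Poly_Mapping.map_key prod.swap (Poly_Mapping.single (q, p) (1::nat)) =
          Poly_Mapping.single (p, q) 1"
    using map_key_single[of prod.swap "(p, q)" "1::nat"] by simp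
  then show ?thesis by (simp add: var_def swap_indices_single)
qed

lemma swap_indices_const:
  "swap_indices (Poly_Mapping.single 0 c) = Poly_Mapping.single 0 c"
  by (simp add: swap_indices_single)

lemma swap_indices_add: "swap_indices (f + g) = swap_indices f + swap_indices g"
  unfolding swap_indices_def by (rule map_key_plus[OF inj_map_key_swap])

lemma poly_mapping_add_induct [case_names zero add]:
  assumes "P 0" and "\<And>f k c. P f \<Longrightarrow> P (f + Poly_Mapping.single k c)"
  shows "P (f :: 'a \<Rightarrow>\<^sub>0 'b::comm_monoid_add)"
proof (induction f rule: update_induct)
  case const
  show ?case by (rule assms(1))
next
  case (update f k c)
  have "Poly_Mapping.update k c f = f + Poly_Mapping.single k c"
    using update(1)
    by (intro poly_mapping_eqI) (auto simp: lookup_update lookup_add lookup_single in_keys_iff when_def)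
  then show ?case using assms(2)[OF update(3)] by simp
qed

lemma swap_indices_mult: "swap_indices (f * g) = swap_indices f * swap_indices g"
proof (induction f rule: poly_mapping_add_induct)
  case zero
  show ?case by (simp add: swap_indices_def map_key_zero[OF inj_map_key_swap])
next
  case (add f m c)
  have "swap_indices (Poly_Mapping.single m c * g) =
          swap_indices (Poly_Mapping.single m c) * swap_indices g"
  proof (induction g rule: poly_mapping_add_induct)
    case zero
    show ?case by (simp add: swap_indices_def map_key_zero[OF inj_map_key_swap])
  next
    case (add g n d)
    then show ?case
      by (simp add: distrib_left swap_indices_add mult_single swap_indices_single map_key_plus)
  qed
  with add show ?case by (simp add: distrib_right swap_indices_add)
qed

end

theory Submission
  imports Defs
begin

text \<open>
  The associated primes of a squarefree monomial ideal are generated by the minimal vertex covers of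
  its generators, so \<open>L(P, Q)\<close> is unmixed iff all minimal sets \<open>C\<close> meeting the graph of every
  order-preserving \<open>\<phi> : P \<rightarrow> Q\<close> have the same size, which is then \<open>|Q|\<close>, the size of \<open>{p} \<times> Q\<close>.
  Constant maps show that such a \<open>C\<close> contains a transposed graph \<open>{(\<psi> y, y)}\<close>, so unmixedness means
  that every cover contains a transposed graph that is itself a cover.

  If \<open>P\<close> is not rooted and \<open>Q\<close> is not co-rooted (or dually), an explicit cover violates this.  If neither
  case occurs, then (a), (b) or (c) holds, because a rooted and co-rooted poset is a
  disjoint union of chains.  Under (a), (b) or (c) any two components \<open>A\<close> of \<open>P\<close> and \<open>B\<close> of \<open>Q\<close> satisfy
  an alternative as in the game of Hex: either some monotone \<open>A \<rightarrow> B\<close> avoids \<open>C\<close>, or some monotone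
  \<open>\<psi> : B \<rightarrow> A\<close> has its transposed graph in \<open>C\<close>.  Moreover \<open>A\<close> or \<open>B\<close> has the fixed point property, and
  since \<open>(\<psi> y, y)\<close> lies on the graph of \<open>\<phi>\<close> iff \<open>y\<close> is fixed by \<open>\<phi> \<circ> \<psi>\<close>, transposed graphs of monotone
  maps into one component are covers.
\<close>

section \<open>Coefficients of products of polynomials\<close>

abbreviation lookup where "lookup \<equiv> Poly_Mapping.lookup"
abbreviation keys where "keys \<equiv> Poly_Mapping.keys"

text \<open>The first assumption leaves one pair of exponents with sum \<open>a + b\<close>, so
  nothing can cancel. This serves the leading term argument in
  \<open>var_ideal_prime\<close>.\<close>

lemma lookup_mult_unique:
  fixes f g :: "'a::monoid_add \<Rightarrow>\<^sub>0 'b::semiring_0"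
  assumes "\<And>a' b'. a' \<in> keys f \<Longrightarrow> b' \<in> keys g \<Longrightarrow> a' + b' = a + b \<Longrightarrow> a' = a \<and> b' = b"
    and "a \<in> keys f" and "b \<in> keys g"
  shows "lookup (f * g) (a + b) = lookup f a * lookup g b"
proof -
  have expand: "h = (\<Sum>a\<in>keys h. Poly_Mapping.single a (lookup h a))" for h :: "'a \<Rightarrow>\<^sub>0 'b"
    by (rule poly_mapping_eqI) (auto simp: lookup_sum lookup_single when_def in_keys_iff)
  have "f * g = (\<Sum>a\<in>keys f. \<Sum>b\<in>keys g. Poly_Mapping.single (a + b) (lookup f a * lookup g b))"
    by (subst expand[of f], subst expand[of g]) (simp add: sum_product mult_single)
  then have "lookup (f * g) (a + b) =
      (\<Sum>a'\<in>keys f. \<Sum>b'\<in>keys g. lookup f a' * lookup g b' when a' + b' = a + b)"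
    by (simp add: lookup_sum lookup_single)
  also have "\<dots> = (\<Sum>a'\<in>keys f. \<Sum>b'\<in>keys g.
      if a' = a then (if b' = b then lookup f a' * lookup g b' else 0) else 0)"
    by (intro sum.cong refl) (use assms(1) in \<open>auto simp: when_def\<close>)
  also have "\<dots> = lookup f a * lookup g b"
  proof -
    have "(\<Sum>b'\<in>keys g. if a' = a then (if b' = b then lookup f a' * lookup g b' else 0) else 0) =
        (if a' = a then lookup f a * lookup g b else 0)" for a'
      using assms(3) by (auto simp: sum.delta)
    then show ?thesis using assms(2) by (simp add: sum.delta)
  qed
  finally show ?thesis .
qed

section \<open>Prime ideals generated by variables\<close>

text \<open>This is the ideal generated by the variables in \<open>C\<close>, given by supports so
  that membership is a condition on each monomial separately.\<close>

definition var_ideal :: "'v set \<Rightarrow> ('v, 'k::field) mpoly set" where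
  "var_ideal C = {f. \<forall>m\<in>keys f. \<exists>v\<in>C. lookup m v \<noteq> 0}"

lemma var_ideal_add: "f \<in> var_ideal C \<Longrightarrow> g \<in> var_ideal C \<Longrightarrow> f + g \<in> var_ideal C"
  using keys_add[of f g] unfolding var_ideal_def by blast

lemma var_ideal_mult: "f \<in> var_ideal C \<Longrightarrow> g * f \<in> var_ideal C"
  unfolding var_ideal_def
proof clarify
  fix m assume f: "\<forall>m\<in>keys f. \<exists>v\<in>C. lookup m v \<noteq> 0" and m: "m \<in> keys (g * f)"
  obtain a b where "m = a + b" "b \<in> keys f"
    using m keys_mult[of g f] by auto
  with f show "\<exists>v\<in>C. lookup m v \<noteq> 0"
    by (metis add_is_0 lookup_add)
qed

lemma keys_var: "keys (var v :: ('v, 'k::field) mpoly) = {Poly_Mapping.single v 1}"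
  by (simp add: var_def)

lemma var_in_var_ideal_iff: "(var v :: ('v, 'k::field) mpoly) \<in> var_ideal C \<longleftrightarrow> v \<in> C"
  by (auto simp: var_ideal_def keys_var lookup_single when_def)

text \<open>Supplies a monomial order: finitely supported functions on \<open>nat\<close> are
  linearly ordered compatibly with addition, while \<open>'v\<close> carries no order.\<close>

lemma exists_additive_injection:
  "\<exists>F :: ('v::finite \<Rightarrow>\<^sub>0 nat) \<Rightarrow> (nat \<Rightarrow>\<^sub>0 nat). inj F \<and> (\<forall>a b. F (a + b) = F a + F b)"
proof -
  obtain e :: "'v \<Rightarrow> nat" where e: "inj e"
    using finite_imp_inj_to_nat_seg[of "UNIV :: 'v set"] by auto
  define F where "F m = (\<Sum>v\<in>UNIV. Poly_Mapping.single (e v) (lookup m v))" for m :: "'v \<Rightarrow>\<^sub>0 nat"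
  have "lookup (F m) (e v) = lookup m v" for m v
  proof -
    have "lookup (F m) (e v) = (\<Sum>w\<in>UNIV. if v = w then lookup m w else 0)"
      unfolding F_def lookup_sum using e
      by (intro sum.cong refl) (auto simp: lookup_single when_def inj_eq)
    then show ?thesis by (simp add: sum.delta)
  qed
  then have "inj F"
    by (metis injI poly_mapping_eqI)
  moreover have "F (a + b) = F a + F b" for a b
    by (simp add: F_def lookup_add single_add sum.distrib)
  ultimately show ?thesis by blast
qed

text \<open>As for polynomial rings over a field being domains: among the monomials free of
  \<open>C\<close>, the largest ones of \<open>f\<close> and \<open>g\<close> in the order pulled
  back along \<open>F\<close> have a product that survives in \<open>f * g\<close>.\<close>

lemma var_ideal_prime:
  fixes f g :: "('v::finite, 'k::field) mpoly"
  assumes "f \<notin> var_ideal C" and "g \<notin> var_ideal C"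
  shows "f * g \<notin> var_ideal C"
proof -
  obtain F :: "('v \<Rightarrow>\<^sub>0 nat) \<Rightarrow> (nat \<Rightarrow>\<^sub>0 nat)"
    where F: "inj F" "\<And>a b. F (a + b) = F a + F b"
    using exists_additive_injection by blast
  define free where "free h = {m \<in> keys h. \<forall>v\<in>C. lookup m v = 0}" for h :: "('v, 'k) mpoly"
  have ex_max: "\<exists>m\<in>free h. \<forall>m'\<in>free h. F m' \<le> F m" if "h \<notin> var_ideal C" for h
  proof -
    have "finite (free h)" "free h \<noteq> {}"
      using that by (auto simp: free_def var_ideal_def)
    then have "Max (F ` free h) \<in> F ` free h"
      by (intro Max_in) auto
    then obtain m where m: "m \<in> free h" "F m = Max (F ` free h)"
      by (metis imageE)
    have "F m' \<le> F m" if "m' \<in> free h" for m'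
      unfolding m(2) using that \<open>finite (free h)\<close> by (intro Max_ge) auto
    with m(1) show ?thesis by blast
  qed
  obtain a where a: "a \<in> free f" "\<And>m. m \<in> free f \<Longrightarrow> F m \<le> F a"
    using ex_max[OF assms(1)] by blast
  obtain b where b: "b \<in> free g" "\<And>m. m \<in> free g \<Longrightarrow> F m \<le> F b"
    using ex_max[OF assms(2)] by blast
  have "lookup (f * g) (a + b) = lookup f a * lookup g b"
  proof (rule lookup_mult_unique)
    fix a' b' assume ab: "a' \<in> keys f" "b' \<in> keys g" "a' + b' = a + b"
    \<comment> \<open>Exponents are natural numbers, so summands of the \<open>C\<close>-free
      \<open>a + b\<close> are \<open>C\<close>-free and can be compared with the two
      maxima.\<close>
    have "lookup a' v = 0 \<and> lookup b' v = 0" if "v \<in> C" for v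
      using arg_cong[OF ab(3), of "\<lambda>m. lookup m v"] a(1) b(1) that
      by (auto simp: lookup_add free_def)
    then have le: "F a' \<le> F a" "F b' \<le> F b"
      using ab a(2) b(2) by (auto simp: free_def)
    have eq: "F a' + F b' = F a + F b"
      using ab(3) F(2) by metis
    have "F a' = F a"
      using le eq add_less_le_mono[of "F a'" "F a" "F b'" "F b"] by fastforce
    moreover from this eq have "F b' = F b" by simp
    ultimately show "a' = a \<and> b' = b"
      using F(1) by (simp add: inj_eq)
  qed (use a(1) b(1) in \<open>auto simp: free_def\<close>)
  also have "\<dots> \<noteq> 0"
    using a(1) b(1) by (auto simp: free_def in_keys_iff)
  finally have "a + b \<in> keys (f * g)" by (simp add: in_keys_iff)
  moreover have "\<forall>v\<in>C. lookup (a + b) v = 0"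
    using a(1) b(1) by (auto simp: free_def lookup_add)
  ultimately show ?thesis by (auto simp: var_ideal_def)
qed

section \<open>Ideals of a type-based ring\<close>

lemma ring_of_type_algebra_simps:
  "carrier ring_of_type_algebra = UNIV"
  "monoid.mult ring_of_type_algebra = (*)"
  "one ring_of_type_algebra = 1"
  "ring.zero ring_of_type_algebra = 0"
  "add ring_of_type_algebra = (+)"
  by (simp_all add: ring_of_type_algebra_def fun_eq_iff)

text \<open>Closure under negation comes from multiplication by \<open>- 1\<close>.\<close>

lemma ideal_ring_of_type_algebra_iff:
  fixes I :: "'a::comm_ring_1 set"
  shows "ideal I ring_of_type_algebra \<longleftrightarrow>
    0 \<in> I \<and> (\<forall>x\<in>I. \<forall>y\<in>I. x + y \<in> I) \<and> (\<forall>x\<in>I. \<forall>r. r * x \<in> I)"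
    (is "_ \<longleftrightarrow> ?closed")
proof
  assume I: "ideal I ring_of_type_algebra"
  then interpret ideal I "ring_of_type_algebra :: 'a ring" .
  show ?closed
    using a_closed zero_closed I_l_closed additive_subgroup.zero_closed[OF is_additive_subgroup]
      additive_subgroup.a_closed[OF is_additive_subgroup]
    by (simp add: ring_of_type_algebra_simps)
next
  assume I: ?closed
  interpret ring "ring_of_type_algebra :: 'a ring" by (rule ring_from_type_algebra)
  have minus: "- x \<in> I" if "x \<in> I" for x
    using I that by (metis mult_minus1)
  have inv: "inv\<^bsub>add_monoid ring_of_type_algebra\<^esub> x = - x" for x :: 'a
    using minus_equality[of "- x" x] by (simp add: a_inv_def ring_of_type_algebra_simps)
  show "ideal I ring_of_type_algebra"
  proof (rule idealI)
    show "subgroup I (add_monoid ring_of_type_algebra)"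
    proof (rule subgroup.intro)
      show "inv\<^bsub>add_monoid ring_of_type_algebra\<^esub> x \<in> I" if "x \<in> I" for x
        using minus[OF that] by (simp only: inv)
    qed (use I in \<open>auto simp: ring_of_type_algebra_simps\<close>)
  qed (use I ring_axioms in \<open>auto simp: ring_of_type_algebra_simps mult.commute\<close>)
qed

lemma primeideal_ring_of_type_algebra_iff:
  fixes I :: "'a::comm_ring_1 set"
  shows "primeideal I ring_of_type_algebra \<longleftrightarrow>
    ideal I ring_of_type_algebra \<and> I \<noteq> UNIV \<and> (\<forall>x y. x * y \<in> I \<longrightarrow> x \<in> I \<or> y \<in> I)"
  unfolding primeideal_def primeideal_axioms_def
  using cring_from_type_algebra by (auto simp: ring_of_type_algebra_simps)

lemma primeideal_var_ideal:
  "primeideal (var_ideal C :: ('v::finite, 'k::field) mpoly set) ring_of_type_algebra"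
proof -
  have "(1 :: ('v, 'k) mpoly) \<notin> var_ideal C" by (simp add: var_ideal_def)
  moreover have "(0 :: ('v, 'k) mpoly) \<in> var_ideal C" by (simp add: var_ideal_def)
  ultimately show ?thesis
    unfolding primeideal_ring_of_type_algebra_iff ideal_ring_of_type_algebra_iff
    using var_ideal_prime var_ideal_add var_ideal_mult by blast
qed

context
  fixes I :: "'a::comm_ring_1 set"
  assumes I: "ideal I ring_of_type_algebra"
begin

lemma ideal_sum_mem: "(\<And>a. a \<in> A \<Longrightarrow> f a \<in> I) \<Longrightarrow> sum f A \<in> I"
  using I by (induction A rule: infinite_finite_induct) (auto simp: ideal_ring_of_type_algebra_iff)

lemma ideal_mult_mem: "x \<in> I \<Longrightarrow> r * x \<in> I"
  using I by (simp add: ideal_ring_of_type_algebra_iff)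

lemma ideal_diff_mem: "x \<in> I \<Longrightarrow> y \<in> I \<Longrightarrow> x - y \<in> I"
  using I unfolding ideal_ring_of_type_algebra_iff
  by (metis diff_conv_add_uminus mult_minus1)

end

context
  fixes I :: "'a::comm_ring_1 set"
  assumes I: "primeideal I ring_of_type_algebra"
begin

lemma primeideal_imp_ideal: "ideal I ring_of_type_algebra"
  using I by (simp add: primeideal_ring_of_type_algebra_iff)

lemma primeideal_one_notin: "1 \<notin> I"
  using I ideal_mult_mem[OF primeideal_imp_ideal, of 1]
  by (auto simp: primeideal_ring_of_type_algebra_iff)

lemma primeideal_mult: "x * y \<in> I \<Longrightarrow> x \<in> I \<or> y \<in> I"
  using I by (simp add: primeideal_ring_of_type_algebra_iff)

lemma primeideal_prod: "finite A \<Longrightarrow> prod f A \<in> I \<Longrightarrow> \<exists>a\<in>A. f a \<in> I"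
  by (induction A rule: finite_induct) (use primeideal_one_notin primeideal_mult in auto)

lemma primeideal_power: "x ^ n \<in> I \<Longrightarrow> x \<in> I"
  by (induction n) (use primeideal_one_notin primeideal_mult in auto)

end

lemma genideal_subset_iff:
  fixes I :: "'a::comm_ring_1 set"
  assumes "ideal I ring_of_type_algebra"
  shows "genideal ring_of_type_algebra S \<subseteq> I \<longleftrightarrow> S \<subseteq> I"
proof -
  interpret ring "ring_of_type_algebra :: 'a ring" by (rule ring_from_type_algebra)
  show ?thesis
    using Idl_subset_ideal[OF assms, of S] by (simp add: ring_of_type_algebra_simps)
qed

text \<open>The usual membership test for monomial ideals: multiplication only enlarges exponents,
  so the right-hand side is an ideal; conversely a polynomial is the sum of its terms, each a
  multiple of a generator.\<close>

lemma genideal_monomials: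
  "genideal ring_of_type_algebra ((\<lambda>m. Poly_Mapping.single m 1) ` G) =
    {f :: ('v, 'k::field) mpoly. \<forall>k\<in>keys f. \<exists>m\<in>G. \<exists>l. k = l + m}" (is "?gen = ?I")
proof
  have "ideal ?I ring_of_type_algebra"
    unfolding ideal_ring_of_type_algebra_iff
  proof (intro conjI ballI allI)
    fix f g assume "f \<in> ?I" "g \<in> ?I"
    then show "f + g \<in> ?I" using keys_add[of f g] by blast
  next
    fix f r assume f: "f \<in> ?I"
    have "\<exists>m\<in>G. \<exists>l. k = l + m" if k: "k \<in> keys (r * f)" for k
    proof -
      obtain a b where "k = a + b" "b \<in> keys f" using k keys_mult[of r f] by auto
      moreover from this(2) f obtain m l where "m \<in> G" "b = l + m" by blast
      ultimately have "m \<in> G" "k = (a + l) + m" by (simp_all add: add.assoc)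
      then show ?thesis by blast
    qed
    then show "r * f \<in> ?I" by blast
  qed auto
  moreover have "\<exists>m'\<in>G. \<exists>l. m = l + m'" if "m \<in> G" for m
    using that by (metis add_0)
  then have "(\<lambda>m. Poly_Mapping.single m 1) ` G \<subseteq> ?I"
    by auto
  ultimately show "?gen \<subseteq> ?I"
    using genideal_subset_iff by blast
next
  interpret ring "ring_of_type_algebra :: ('v, 'k) mpoly ring" by (rule ring_from_type_algebra)
  have gen: "ideal ?gen ring_of_type_algebra"
    by (rule genideal_ideal) (simp add: ring_of_type_algebra_simps)
  have sub: "(\<lambda>m. Poly_Mapping.single m 1) ` G \<subseteq> ?gen"
    using genideal_self by (simp add: ring_of_type_algebra_simps)
  show "?I \<subseteq> ?gen"
  proof
    fix f assume f: "f \<in> ?I"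
    have "(\<Sum>k\<in>keys f. Poly_Mapping.single k (lookup f k)) \<in> ?gen"
    proof (rule ideal_sum_mem[OF gen])
      fix k assume "k \<in> keys f"
      with f obtain m l where m: "m \<in> G" "k = l + m" by blast
      have "Poly_Mapping.single k (lookup f k) =
          Poly_Mapping.single l (lookup f k) * Poly_Mapping.single m 1"
        by (simp add: mult_single m(2))
      then show "Poly_Mapping.single k (lookup f k) \<in> ?gen"
        using ideal_mult_mem[OF gen] sub m(1) by auto
    qed
    moreover have "f = (\<Sum>k\<in>keys f. Poly_Mapping.single k (lookup f k))"
      by (rule poly_mapping_eqI) (auto simp: lookup_sum lookup_single when_def in_keys_iff)
    ultimately show "f \<in> ?gen" by simp
  qed
qed

section \<open>Squarefree monomial ideals and vertex covers\<close>

text \<open>\<open>H\<close> is read as a hypergraph on the variables. With finitely many variables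
  every squarefree monomial ideal has this form.\<close>

definition edge_ideal :: "'v set set \<Rightarrow> ('v, 'k::field) mpoly set" where
  "edge_ideal H = genideal ring_of_type_algebra ((\<lambda>E. \<Prod>v\<in>E. var v) ` H)"

definition vertex_cover :: "'v set set \<Rightarrow> 'v set \<Rightarrow> bool" where
  "vertex_cover H C \<longleftrightarrow> (\<forall>E\<in>H. E \<inter> C \<noteq> {})"

definition minimal_cover :: "'v set set \<Rightarrow> 'v set \<Rightarrow> bool" where
  "minimal_cover H C \<longleftrightarrow> vertex_cover H C \<and> (\<forall>D. vertex_cover H D \<longrightarrow> D \<subseteq> C \<longrightarrow> D = C)"

lemma vertex_cover_contains_minimal:
  fixes C :: "'v::finite set"
  assumes "vertex_cover H C"
  obtains D where "minimal_cover H D" "D \<subseteq> C"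
proof -
  obtain D where D: "D \<in> {D. vertex_cover H D}" "D \<subseteq> C"
    and min: "\<forall>B\<in>{D. vertex_cover H D}. B \<subseteq> D \<longrightarrow> D = B"
    using finite_has_minimal2[of "{D. vertex_cover H D}" C] assms by auto
  then have "minimal_cover H D"
    unfolding minimal_cover_def by auto
  then show ?thesis using D(2) by (rule that)
qed

definition indicator_exponent :: "'v set \<Rightarrow> ('v \<Rightarrow>\<^sub>0 nat)" where
  "indicator_exponent E = (\<Sum>v\<in>E. Poly_Mapping.single v 1)"

lemma lookup_indicator_exponent:
  "finite E \<Longrightarrow> lookup (indicator_exponent E) v = (if v \<in> E then 1 else 0)"
  by (simp add: indicator_exponent_def lookup_sum lookup_single when_def sum.delta)

lemma prod_var: "(\<Prod>v\<in>E. var v :: ('v, 'k::field) mpoly) = Poly_Mapping.single (indicator_exponent E) 1"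
  unfolding indicator_exponent_def
  by (induction E rule: infinite_finite_induct) (simp_all add: var_def mult_single)

lemma indicator_exponent_divides_iff:
  fixes m :: "'v \<Rightarrow>\<^sub>0 nat"
  assumes "finite E"
  shows "(\<exists>l. m = l + indicator_exponent E) \<longleftrightarrow> (\<forall>v\<in>E. lookup m v \<noteq> 0)"
proof
  assume "\<exists>l. m = l + indicator_exponent E"
  then show "\<forall>v\<in>E. lookup m v \<noteq> 0"
    using assms by (auto simp: lookup_add lookup_indicator_exponent)
next
  assume m: "\<forall>v\<in>E. lookup m v \<noteq> 0"
  have "m = (m - indicator_exponent E) + indicator_exponent E"
    by (rule poly_mapping_eqI)
      (use m in \<open>auto simp: lookup_add lookup_minus lookup_indicator_exponent[OF assms] Suc_leI\<close>)
  then show "\<exists>l. m = l + indicator_exponent E" by blast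
qed

text \<open>Divisibility by a squarefree monomial depends only on supports, which links the ideal to
  covers.\<close>

lemma mem_edge_ideal_iff:
  fixes f :: "('v::finite, 'k::field) mpoly"
  shows "f \<in> edge_ideal H \<longleftrightarrow> (\<forall>m\<in>keys f. \<exists>E\<in>H. \<forall>v\<in>E. lookup m v \<noteq> 0)"
proof -
  have "(\<lambda>E. \<Prod>v\<in>E. var v :: ('v, 'k) mpoly) ` H =
      (\<lambda>m. Poly_Mapping.single m 1) ` (indicator_exponent ` H)"
    by (simp add: prod_var image_image)
  then show ?thesis
    by (simp add: edge_ideal_def genideal_monomials indicator_exponent_divides_iff)
qed

lemma ideal_edge_ideal:
  "ideal (edge_ideal H :: ('v, 'k::field) mpoly set) ring_of_type_algebra"
proof -
  interpret ring "ring_of_type_algebra :: ('v, 'k) mpoly ring" by (rule ring_from_type_algebra)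
  show ?thesis
    unfolding edge_ideal_def by (rule genideal_ideal) (simp add: ring_of_type_algebra_simps)
qed

lemma edge_ideal_subset_iff:
  assumes "ideal I ring_of_type_algebra"
  shows "edge_ideal H \<subseteq> I \<longleftrightarrow> (\<forall>E\<in>H. (\<Prod>v\<in>E. var v) \<in> I)"
  using genideal_subset_iff[OF assms] by (auto simp: edge_ideal_def)

text \<open>A prime contains a product of variables iff it contains one of the factors.\<close>

lemma edge_ideal_subset_prime:
  fixes P :: "('v::finite, 'k::field) mpoly set"
  assumes "primeideal P ring_of_type_algebra"
  shows "edge_ideal H \<subseteq> P \<longleftrightarrow> vertex_cover H {v. var v \<in> P}"
proof -
  have "(\<Prod>v\<in>E. var v) \<in> P \<longleftrightarrow> E \<inter> {v. var v \<in> P} \<noteq> {}" for E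
  proof
    show "(\<Prod>v\<in>E. var v) \<in> P \<Longrightarrow> E \<inter> {v. var v \<in> P} \<noteq> {}"
      using primeideal_prod[OF assms, of E var] by auto
    assume "E \<inter> {v. var v \<in> P} \<noteq> {}"
    then obtain v where "v \<in> E" "var v \<in> P" by blast
    then have "(\<Prod>w\<in>E. var w) = (\<Prod>w\<in>E - {v}. var w) * (var v :: ('v, 'k) mpoly)"
      by (simp add: prod.remove[of E v] mult.commute)
    then show "(\<Prod>v\<in>E. var v) \<in> P"
      using ideal_mult_mem[OF primeideal_imp_ideal[OF assms] \<open>var v \<in> P\<close>] by simp
  qed
  then show ?thesis
    using edge_ideal_subset_iff[OF primeideal_imp_ideal[OF assms]] by (simp add: vertex_cover_def)
qed

lemma vars_of_var_ideal [simp]: "{v. (var v :: ('v, 'k::field) mpoly) \<in> var_ideal C} = C"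
  by (simp add: var_in_var_ideal_iff)

lemma edge_ideal_subset_var_ideal:
  "(edge_ideal H :: ('v::finite, 'k::field) mpoly set) \<subseteq> var_ideal C \<longleftrightarrow> vertex_cover H C"
  using edge_ideal_subset_prime[OF primeideal_var_ideal, of H C] by simp

text \<open>\<open>var_ideal C\<close> is the edge ideal of the singletons in \<open>C\<close>,
  hence generated by variables.\<close>

lemma var_ideal_subset_iff:
  fixes P :: "('v::finite, 'k::field) mpoly set"
  assumes "ideal P ring_of_type_algebra"
  shows "var_ideal C \<subseteq> P \<longleftrightarrow> C \<subseteq> {v. var v \<in> P}"
proof -
  have "(\<exists>E\<in>(\<lambda>v. {v}) ` C. \<forall>v\<in>E. lookup m v \<noteq> 0) \<longleftrightarrow> (\<exists>v\<in>C. lookup m v \<noteq> 0)"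
    for m :: "'v \<Rightarrow>\<^sub>0 nat" by auto
  then have "(var_ideal C :: ('v, 'k) mpoly set) = edge_ideal ((\<lambda>v. {v}) ` C)"
    by (auto simp: var_ideal_def mem_edge_ideal_iff)
  then show ?thesis
    using edge_ideal_subset_iff[OF assms, of "(\<lambda>v. {v}) ` C"] by auto
qed

text \<open>The prime decomposition. If no edge divides a monomial of \<open>f\<close>, the
  variables absent from that monomial form a cover, and a minimal cover inside it gives a prime
  missing \<open>f\<close>.\<close>

lemma edge_ideal_eq_Inter:
  fixes f :: "('v::finite, 'k::field) mpoly"
  shows "f \<in> edge_ideal H \<longleftrightarrow> (\<forall>C. minimal_cover H C \<longrightarrow> f \<in> var_ideal C)"
proof
  assume "f \<in> edge_ideal H"
  then show "\<forall>C. minimal_cover H C \<longrightarrow> f \<in> var_ideal C"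
    using edge_ideal_subset_var_ideal by (auto simp: minimal_cover_def)
next
  assume f: "\<forall>C. minimal_cover H C \<longrightarrow> f \<in> var_ideal C"
  show "f \<in> edge_ideal H"
    unfolding mem_edge_ideal_iff
  proof (rule ballI, rule ccontr)
    fix m assume m: "m \<in> keys f" "\<not> (\<exists>E\<in>H. \<forall>v\<in>E. lookup m v \<noteq> 0)"
    then have "vertex_cover H {v. lookup m v = 0}" by (auto simp: vertex_cover_def)
    then obtain C where "minimal_cover H C" "C \<subseteq> {v. lookup m v = 0}"
      by (rule vertex_cover_contains_minimal)
    with f m(1) show False by (fastforce simp: var_ideal_def)
  qed
qed

text \<open>A prime over the edge ideal contains \<open>var_ideal C\<close> for a minimal cover
  \<open>C\<close> among its variables; this is itself a prime over the ideal, so minimality forces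
  equality.\<close>

lemma minimal_primes_edge_ideal:
  "minimal_primes ring_of_type_algebra (edge_ideal H :: ('v::finite, 'k::field) mpoly set) =
    var_ideal ` {C. minimal_cover H C}"
proof (intro equalityI subsetI)
  fix P :: "('v, 'k) mpoly set"
  assume "P \<in> minimal_primes ring_of_type_algebra (edge_ideal H)"
  then have P: "primeideal P ring_of_type_algebra" "edge_ideal H \<subseteq> P"
    and min: "\<And>Q. primeideal Q ring_of_type_algebra \<Longrightarrow> edge_ideal H \<subseteq> Q \<Longrightarrow> \<not> Q \<subset> P"
    by (auto simp: minimal_primes_def)
  have "vertex_cover H {v. var v \<in> P}"
    using P edge_ideal_subset_prime by blast
  then obtain C where C: "minimal_cover H C" "C \<subseteq> {v. var v \<in> P}"
    by (rule vertex_cover_contains_minimal)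
  then have "var_ideal C \<subseteq> P"
    using var_ideal_subset_iff[OF primeideal_imp_ideal[OF P(1)]] by blast
  moreover have "edge_ideal H \<subseteq> (var_ideal C :: ('v, 'k) mpoly set)"
    using C(1) edge_ideal_subset_var_ideal by (auto simp: minimal_cover_def)
  ultimately have "P = var_ideal C"
    using min[OF primeideal_var_ideal] by blast
  with C(1) show "P \<in> var_ideal ` {C. minimal_cover H C}" by blast
next
  fix P :: "('v, 'k) mpoly set"
  assume "P \<in> var_ideal ` {C. minimal_cover H C}"
  then obtain C where C: "P = var_ideal C" "minimal_cover H C" by blast
  have "\<not> Q \<subset> P" if Q: "primeideal Q ring_of_type_algebra" "edge_ideal H \<subseteq> Q" for Q
  proof
    assume "Q \<subset> P"
    then have "{v. var v \<in> Q} \<subseteq> {v. (var v :: ('v, 'k) mpoly) \<in> var_ideal C}"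
      unfolding C(1) by blast
    then have "{v. var v \<in> Q} \<subseteq> C" by simp
    moreover have "vertex_cover H {v. var v \<in> Q}"
      using edge_ideal_subset_prime[OF Q(1)] Q(2) by simp
    ultimately have "{v. var v \<in> Q} = C"
      using C(2) by (simp add: minimal_cover_def)
    then have "var_ideal C \<subseteq> Q"
      using var_ideal_subset_iff[OF primeideal_imp_ideal[OF Q(1)], of C] by simp
    with \<open>Q \<subset> P\<close> C(1) show False by blast
  qed
  moreover have "edge_ideal H \<subseteq> P"
    using C edge_ideal_subset_var_ideal by (auto simp: minimal_cover_def)
  ultimately show "P \<in> minimal_primes ring_of_type_algebra (edge_ideal H)"
    by (auto simp: minimal_primes_def C(1) primeideal_var_ideal)
qed

text \<open>By \<open>edge_ideal_eq_Inter\<close> the annihilator of \<open>f\<close> is the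
  intersection of the \<open>var_ideal C\<close> that miss \<open>f\<close>; a prime that is a
  finite intersection of ideals equals one of them.\<close>

lemma associated_primes_edge_ideal:
  "associated_primes ring_of_type_algebra (edge_ideal H :: ('v::finite, 'k::field) mpoly set) =
    var_ideal ` {C. minimal_cover H C}"
proof (intro equalityI subsetI)
  fix P :: "('v, 'k) mpoly set"
  assume "P \<in> associated_primes ring_of_type_algebra (edge_ideal H)"
  then obtain f where P: "primeideal P ring_of_type_algebra" and f: "P = {g. g * f \<in> edge_ideal H}"
    by (auto simp: associated_primes_def ring_of_type_algebra_simps)
  let ?\<C> = "{C. minimal_cover H C \<and> f \<notin> var_ideal C}"
  have P_iff: "g \<in> P \<longleftrightarrow> (\<forall>C\<in>?\<C>. g \<in> var_ideal C)" for g
    using var_ideal_prime[of g _ f] var_ideal_mult[of g _ f] var_ideal_mult[of f _ g]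
    unfolding f edge_ideal_eq_Inter by (auto simp: mult.commute)
  have "\<exists>C\<in>?\<C>. var_ideal C \<subseteq> P"
  proof (rule ccontr)
    assume "\<not> ?thesis"
    then have "\<forall>C\<in>?\<C>. \<exists>g. g \<in> var_ideal C \<and> g \<notin> P" by blast
    then obtain h where h: "\<And>C. C \<in> ?\<C> \<Longrightarrow> h C \<in> var_ideal C \<and> h C \<notin> P" by metis
    have "(\<Prod>C\<in>?\<C>. h C) \<in> var_ideal C" if "C \<in> ?\<C>" for C
    proof -
      have "prod h ?\<C> = prod h (?\<C> - {C}) * h C"
        using that by (subst prod.remove[of ?\<C> C]) (simp_all add: mult.commute)
      then show ?thesis
        using var_ideal_mult[of "h C" C "prod h (?\<C> - {C})"] h[OF that] by simp
    qed
    then have "(\<Prod>C\<in>?\<C>. h C) \<in> P" using P_iff by blast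
    then obtain C where "C \<in> ?\<C>" "h C \<in> P"
      using primeideal_prod[OF P, of ?\<C> h] by auto
    with h show False by blast
  qed
  then obtain C where C: "C \<in> ?\<C>" "var_ideal C \<subseteq> P" by blast
  then have "P = var_ideal C" using P_iff by blast
  with C(1) show "P \<in> var_ideal ` {C. minimal_cover H C}" by blast
next
  fix P :: "('v, 'k) mpoly set"
  assume "P \<in> var_ideal ` {C. minimal_cover H C}"
  then obtain C where C: "P = var_ideal C" "minimal_cover H C" by blast
  \<comment> \<open>The product of the variables outside \<open>C\<close> has annihilator
    \<open>var_ideal C\<close>: by minimality each \<open>v\<close> in \<open>C\<close> is the only
    vertex of \<open>C\<close> on some edge, and \<open>var v * f\<close> is divisible by that
    edge.\<close>
  define m where "m = indicator_exponent (- C)"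
  define f :: "('v, 'k) mpoly" where "f = Poly_Mapping.single m 1"
  have f_notin: "f \<notin> var_ideal C"
    by (simp add: f_def m_def var_ideal_def lookup_indicator_exponent)
  have "var v * f \<in> edge_ideal H" if v: "v \<in> C" for v
  proof -
    have "\<not> vertex_cover H (C - {v})"
      using C(2) v unfolding minimal_cover_def by blast
    then obtain E where E: "E \<in> H" "E \<inter> (C - {v}) = {}"
      unfolding vertex_cover_def by blast
    have "\<forall>w\<in>E. lookup (Poly_Mapping.single v 1 + m) w \<noteq> 0"
      using E(2) by (auto simp: lookup_add m_def lookup_indicator_exponent lookup_single when_def)
    with E(1) show ?thesis
      by (auto simp: mem_edge_ideal_iff var_def f_def mult_single)
  qed
  moreover have "ideal {g. g * f \<in> edge_ideal H} ring_of_type_algebra"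
    using ideal_edge_ideal[of H]
    by (auto simp: ideal_ring_of_type_algebra_iff distrib_right mult.assoc)
  ultimately have "var_ideal C \<subseteq> {g. g * f \<in> edge_ideal H}"
    using var_ideal_subset_iff by blast
  moreover have "{g. g * f \<in> edge_ideal H} \<subseteq> var_ideal C"
    using f_notin var_ideal_prime[of _ C f] edge_ideal_eq_Inter[of _ H] C(2) by blast
  ultimately have "var_ideal C = {g. g * f \<in> edge_ideal H}" by (rule subset_antisym)
  then show "P \<in> associated_primes ring_of_type_algebra (edge_ideal H)"
    unfolding associated_primes_def C(1) ring_of_type_algebra_simps
    using primeideal_var_ideal[of C, where 'k = 'k] by auto
qed

lemma alexander_dual_edge_ideal:
  "alexander_dual (edge_ideal H :: ('v::finite, 'k::field) mpoly set) =
    edge_ideal {C. minimal_cover H C}"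
proof -
  have "{(\<Prod>v\<in>{v. (var v :: ('v, 'k) mpoly) \<in> P}. var v) | P.
        P \<in> minimal_primes ring_of_type_algebra (edge_ideal H)} =
      (\<lambda>P. \<Prod>v\<in>{v. (var v :: ('v, 'k) mpoly) \<in> P}. var v) ` var_ideal ` {C. minimal_cover H C}"
    unfolding minimal_primes_edge_ideal by blast
  also have "\<dots> = (\<lambda>C. \<Prod>v\<in>C. var v :: ('v, 'k) mpoly) ` {C. minimal_cover H C}"
    by (simp add: image_image)
  finally show ?thesis
    unfolding alexander_dual_def by (simp only: edge_ideal_def[of "{C. minimal_cover H C}"])
qed

text \<open>\<open>swap_indices\<close> is an involution, so the single inclusion
  \<open>mem\<close>, stated for arbitrary index types, yields both.\<close>

lemma swap_indices_edge_ideal: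
  "swap_indices ` (edge_ideal H :: ('q::finite \<times> 'p::finite, 'k::field) mpoly set) =
    edge_ideal ((`) prod.swap ` H)"
proof -
  have inv: "swap_indices (swap_indices f) = f" for f :: "('a \<times> 'b, 'k) mpoly"
    by (rule poly_mapping_eqI) (simp add: swap_indices_def map_key.rep_eq inj_map_key_swap)
  have mem: "swap_indices f \<in> edge_ideal ((`) prod.swap ` H)" if "f \<in> edge_ideal H"
    for f :: "('a::finite \<times> 'b::finite, 'k) mpoly" and H
    unfolding mem_edge_ideal_iff
  proof
    fix m assume "m \<in> keys (swap_indices f)"
    then have "Poly_Mapping.map_key prod.swap m \<in> keys f"
      by (simp add: in_keys_iff swap_indices_def map_key.rep_eq inj_map_key_swap)
    with that obtain E where "E \<in> H" "\<forall>v\<in>E. lookup (Poly_Mapping.map_key prod.swap m) v \<noteq> 0"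
      unfolding mem_edge_ideal_iff by blast
    then show "\<exists>E\<in>(`) prod.swap ` H. \<forall>v\<in>E. lookup m v \<noteq> 0"
      by (auto simp: map_key.rep_eq)
  qed
  have "g \<in> swap_indices ` edge_ideal H" if "g \<in> edge_ideal ((`) prod.swap ` H)"
    for g :: "('p \<times> 'q, 'k) mpoly"
  proof (rule image_eqI)
    show "g = swap_indices (swap_indices g)" by (simp add: inv)
    show "swap_indices g \<in> edge_ideal H"
      using mem[OF that] by (simp add: image_image)
  qed
  then show ?thesis using mem[of _ H] by blast
qed

section \<open>The height of a prime generated by variables\<close>

text \<open>The linear algebra behind the dimension count, for indexed families: a repeated vector
  gives the relation \<open>x i - x j = 0\<close>; otherwise the image is too large to be
  independent.\<close>

lemma (in vector_space) linear_relation_of_span: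
  assumes "finite T" and "finite I" and "card T < card I" and "\<And>i. i \<in> I \<Longrightarrow> x i \<in> span T"
  obtains u where "\<exists>i\<in>I. u i \<noteq> 0" and "(\<Sum>i\<in>I. u i *s x i) = 0"
proof (cases "inj_on x I")
  case True
  then have "card (x ` I) = card I" by (rule card_image)
  with assms have "dependent (x ` I)"
    using independent_span_bound[of T "x ` I"] by fastforce
  then obtain w where w: "\<exists>y\<in>x ` I. w y \<noteq> 0" "(\<Sum>y\<in>x ` I. w y *s y) = 0"
    using dependent_finite[of "x ` I"] assms(2) by auto
  show ?thesis
    by (rule that[of "w \<circ> x"]) (use w True in \<open>auto simp: sum.reindex\<close>)
next
  case False
  then obtain i j where ij: "i \<in> I" "j \<in> I" "i \<noteq> j" "x i = x j" by (auto simp: inj_on_def)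
  define u :: "_ \<Rightarrow> 'a" where "u k = (if k = i then 1 else if k = j then - 1 else 0)" for k
  have "(\<Sum>k\<in>I. u k *s x k) = (\<Sum>k\<in>{i, j}. u k *s x k)"
    by (rule sum.mono_neutral_right) (use assms(2) ij in \<open>auto simp: u_def\<close>)
  also have "\<dots> = 0" using ij by (simp add: u_def)
  finally show ?thesis
    by (rule that[rotated]) (use ij in \<open>auto simp: u_def\<close>)
qed

text \<open>
  The relation is successively divided by powers of \<open>y 0\<close>, \<open>y 1\<close>, \<open>\<dots>\<close>, retaining at each step only
  the terms of minimal exponent; what remains at the end is a single coefficient.
\<close>

lemma prime_chain_no_relation:
  fixes y :: "nat \<Rightarrow> 'a::comm_ring_1"
  assumes prime: "\<And>i. i \<le> m \<Longrightarrow> primeideal (c i) ring_of_type_algebra"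
    and chain: "\<And>i. i < m \<Longrightarrow> c i \<subseteq> c (Suc i)"
    and y: "\<And>i. i < m \<Longrightarrow> y i \<in> c (Suc i) \<and> y i \<notin> c i"
    and E: "finite E" "E \<noteq> {}" "E \<subseteq> {..<m} \<rightarrow>\<^sub>E UNIV"
    and b: "\<And>\<alpha>. \<alpha> \<in> E \<Longrightarrow> b \<alpha> \<notin> c m"
  shows "(\<Sum>\<alpha>\<in>E. b \<alpha> * (\<Prod>i<m. y i ^ \<alpha> i)) \<notin> c 0"
proof
  assume rel: "(\<Sum>\<alpha>\<in>E. b \<alpha> * (\<Prod>i<m. y i ^ \<alpha> i)) \<in> c 0"
  have "\<exists>D\<subseteq>E. D \<noteq> {} \<and> (\<forall>\<alpha>\<in>D. \<forall>\<beta>\<in>D. \<forall>i<j. \<alpha> i = \<beta> i) \<and>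
      (\<Sum>\<alpha>\<in>D. b \<alpha> * (\<Prod>i\<in>{j..<m}. y i ^ \<alpha> i)) \<in> c j" if "j \<le> m" for j
    using that
  proof (induction j)
    case 0
    show ?case by (rule exI[of _ E]) (use rel E(2) in \<open>auto simp: atLeast0LessThan\<close>)
  next
    case (Suc j)
    then obtain D where D: "D \<subseteq> E" "D \<noteq> {}" "\<forall>\<alpha>\<in>D. \<forall>\<beta>\<in>D. \<forall>i<j. \<alpha> i = \<beta> i"
      and mem: "(\<Sum>\<alpha>\<in>D. b \<alpha> * (\<Prod>i\<in>{j..<m}. y i ^ \<alpha> i)) \<in> c j" by auto
    have fin: "finite D" using D(1) E(1) by (rule finite_subset)
    define a where "a = Min ((\<lambda>\<alpha>. \<alpha> j) ` D)"
    have a_le: "a \<le> \<alpha> j" if "\<alpha> \<in> D" for \<alpha>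
      unfolding a_def using fin that by simp
    define t where "t \<alpha> = b \<alpha> * (\<Prod>i\<in>{Suc j..<m}. y i ^ \<alpha> i)" for \<alpha>
    define D' where "D' = {\<alpha>\<in>D. \<alpha> j = a}"
    have "a \<in> (\<lambda>\<alpha>. \<alpha> j) ` D"
      unfolding a_def using fin D(2) by (intro Min_in) auto
    then have "D' \<noteq> {}" by (auto simp: D'_def)
    have "b \<alpha> * (\<Prod>i\<in>{j..<m}. y i ^ \<alpha> i) = y j ^ a * (y j ^ (\<alpha> j - a) * t \<alpha>)" if "\<alpha> \<in> D" for \<alpha>
    proof -
      have "(\<Prod>i\<in>{j..<m}. y i ^ \<alpha> i) = y j ^ \<alpha> j * (\<Prod>i\<in>{Suc j..<m}. y i ^ \<alpha> i)"
        using Suc.prems by (simp add: prod.atLeast_Suc_lessThan)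
      moreover have "y j ^ \<alpha> j = y j ^ a * y j ^ (\<alpha> j - a)"
        using a_le[OF that] by (simp flip: power_add)
      ultimately show ?thesis by (simp add: t_def mult_ac)
    qed
    then have "(\<Sum>\<alpha>\<in>D. b \<alpha> * (\<Prod>i\<in>{j..<m}. y i ^ \<alpha> i)) =
        y j ^ a * (\<Sum>\<alpha>\<in>D. y j ^ (\<alpha> j - a) * t \<alpha>)"
      by (simp add: sum_distrib_left)
    with mem have "y j ^ a * (\<Sum>\<alpha>\<in>D. y j ^ (\<alpha> j - a) * t \<alpha>) \<in> c j" by simp
    then have "y j ^ a \<in> c j \<or> (\<Sum>\<alpha>\<in>D. y j ^ (\<alpha> j - a) * t \<alpha>) \<in> c j"
      using primeideal_mult[OF prime] Suc.prems by simp
    then have "(\<Sum>\<alpha>\<in>D. y j ^ (\<alpha> j - a) * t \<alpha>) \<in> c j"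
      using primeideal_power[OF prime] y Suc.prems by (meson Suc_leD Suc_le_lessD)
    then have total: "(\<Sum>\<alpha>\<in>D. y j ^ (\<alpha> j - a) * t \<alpha>) \<in> c (Suc j)"
      using chain[of j] Suc.prems by (meson Suc_le_lessD subsetD)
    have I: "ideal (c (Suc j)) ring_of_type_algebra"
      using prime Suc.prems primeideal_imp_ideal by blast
    \<comment> \<open>Terms of larger exponent keep a factor \<open>y j\<close>, which lies in the
      next prime of the chain.\<close>
    have rest: "(\<Sum>\<alpha>\<in>D - D'. y j ^ (\<alpha> j - a) * t \<alpha>) \<in> c (Suc j)"
    proof (rule ideal_sum_mem[OF I])
      fix \<alpha> assume "\<alpha> \<in> D - D'"
      then have "\<alpha> j - a = Suc (\<alpha> j - a - 1)"
        using a_le[of \<alpha>] by (auto simp: D'_def)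
      then have "y j ^ (\<alpha> j - a) * t \<alpha> = (y j ^ (\<alpha> j - a - 1) * t \<alpha>) * y j"
        by (metis mult.assoc mult.commute power_Suc)
      then show "y j ^ (\<alpha> j - a) * t \<alpha> \<in> c (Suc j)"
        using ideal_mult_mem[OF I] y Suc.prems by simp
    qed
    have "(\<Sum>\<alpha>\<in>D. y j ^ (\<alpha> j - a) * t \<alpha>) =
        (\<Sum>\<alpha>\<in>D - D'. y j ^ (\<alpha> j - a) * t \<alpha>) + (\<Sum>\<alpha>\<in>D'. y j ^ (\<alpha> j - a) * t \<alpha>)"
      by (rule sum.subset_diff) (use fin in \<open>auto simp: D'_def\<close>)
    then have "(\<Sum>\<alpha>\<in>D'. y j ^ (\<alpha> j - a) * t \<alpha>) =
        (\<Sum>\<alpha>\<in>D. y j ^ (\<alpha> j - a) * t \<alpha>) - (\<Sum>\<alpha>\<in>D - D'. y j ^ (\<alpha> j - a) * t \<alpha>)"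
      by simp
    then have "(\<Sum>\<alpha>\<in>D'. y j ^ (\<alpha> j - a) * t \<alpha>) \<in> c (Suc j)"
      using ideal_diff_mem[OF I total rest] by simp
    then have "(\<Sum>\<alpha>\<in>D'. t \<alpha>) \<in> c (Suc j)"
      by (simp add: D'_def)
    moreover have "\<forall>\<alpha>\<in>D'. \<forall>\<beta>\<in>D'. \<forall>i<Suc j. \<alpha> i = \<beta> i"
      using D(3) by (auto simp: D'_def less_Suc_eq)
    moreover have "D' \<subseteq> E" using D(1) by (auto simp: D'_def)
    ultimately show ?case
      using \<open>D' \<noteq> {}\<close> unfolding t_def by blast
  qed
  from this[of m] obtain D where D: "D \<subseteq> E" "D \<noteq> {}" "\<forall>\<alpha>\<in>D. \<forall>\<beta>\<in>D. \<forall>i<m. \<alpha> i = \<beta> i"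
    and mem: "sum b D \<in> c m" by auto
  obtain \<alpha> where \<alpha>: "\<alpha> \<in> D" using D(2) by blast
  \<comment> \<open>Members of \<open>E\<close> are extensional on \<open>{..<m}\<close>, so
    agreement below \<open>m\<close> is equality.\<close>
  have "\<beta> = \<alpha>" if "\<beta> \<in> D" for \<beta>
    using D(1,3) E(3) that \<alpha> by (intro PiE_ext[of \<beta> "{..<m}" "\<lambda>_. UNIV" \<alpha>]) auto
  then have "D = {\<alpha>}" using \<alpha> by blast
  with mem b \<alpha> D(1) show False by auto
qed

section \<open>Counting monomials with bounded exponents\<close>

lemma card_exponent_box:
  fixes B :: "'v::finite \<Rightarrow> nat"
  shows "finite {k :: 'v \<Rightarrow>\<^sub>0 nat. \<forall>v. lookup k v \<le> B v}"
    and "card {k :: 'v \<Rightarrow>\<^sub>0 nat. \<forall>v. lookup k v \<le> B v} = (\<Prod>v\<in>UNIV. Suc (B v))"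
proof -
  have "bij_betw lookup {k :: 'v \<Rightarrow>\<^sub>0 nat. \<forall>v. lookup k v \<le> B v} (Pi\<^sub>E UNIV (\<lambda>v. {..B v}))"
  proof (rule bij_betwI[where g = Abs_poly_mapping])
    show "lookup \<in> {k. \<forall>v. lookup k v \<le> B v} \<rightarrow> Pi\<^sub>E UNIV (\<lambda>v. {..B v})" by auto
    show "Abs_poly_mapping \<in> (Pi\<^sub>E UNIV (\<lambda>v. {..B v})) \<rightarrow> {k. \<forall>v. lookup k v \<le> B v}" by auto
  qed (auto simp: lookup_inverse)
  moreover have "finite (Pi\<^sub>E UNIV (\<lambda>v. {..B v}))" by (rule finite_PiE) auto
  ultimately show "finite {k :: 'v \<Rightarrow>\<^sub>0 nat. \<forall>v. lookup k v \<le> B v}"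
    and "card {k :: 'v \<Rightarrow>\<^sub>0 nat. \<forall>v. lookup k v \<le> B v} = (\<Prod>v\<in>UNIV. Suc (B v))"
    by (simp_all add: bij_betw_finite bij_betw_same_card card_PiE)
qed

text \<open>The right side counts the products to be related, the left side the monomials available
  to them. \<open>d\<close> lets the exponent \<open>Suc c\<close> beat \<open>c\<close> with a
  factor two to spare; \<open>e\<close> is then so large that shifting it by \<open>T\<close> costs
  at most a factor two.\<close>

lemma exponent_counting:
  fixes c r D :: nat
  obtains d e where
    "(Suc c * d * D + 1) ^ c * (e + Suc c * d * D + 1) ^ r < (d + 1) ^ Suc c * (e + 1) ^ r"
proof -
  define K where "K = Suc c * D + 1"
  define d where "d = 2 * K ^ c"
  define T where "T = Suc c * d * D"
  define e where "e = 2 * r * T"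
  have "T + 1 \<le> (d + 1) * K"
    by (simp add: T_def K_def algebra_simps)
  then have "(T + 1) ^ c \<le> (d + 1) ^ c * K ^ c"
    by (metis power_mono power_mult_distrib zero_le)
  then have "2 * (T + 1) ^ c \<le> (d + 1) ^ c * d"
    by (simp add: d_def)
  also have "\<dots> < (d + 1) ^ Suc c" by simp
  finally have 1: "2 * (T + 1) ^ c < (d + 1) ^ Suc c" .
  have 2: "(e + T + 1) ^ r \<le> 2 * (e + 1) ^ r"
  proof -
    \<comment> \<open>\<open>1 - x\<close> is the ratio of \<open>e + 1\<close> to
      \<open>e + T + 1\<close>, and \<open>r * x\<close> is at most one half by the choice of
      \<open>e\<close>; Bernoulli then bounds the \<open>r\<close>-th power of the ratio from
      below.\<close>
    define x where "x = real T / real (e + T + 1)"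
    have "0 < real (e + T + 1)"
      by (metis add_gr_0 of_nat_0_less_iff zero_less_one)
    moreover have "2 * (real r * real T) \<le> real (e + T + 1)"
      by (simp add: e_def)
    ultimately have "real r * x \<le> 1 / 2"
      unfolding x_def by (simp add: pos_divide_le_eq del: of_nat_add)
    moreover have x: "0 \<le> x" "x \<le> 1" by (simp_all add: x_def)
    ultimately have "1 / 2 \<le> 1 + real r * (- x)" by simp
    also have "\<dots> \<le> (1 + (- x)) ^ r" using x by (intro Bernoulli_inequality) simp
    also have "1 + (- x) = real (e + 1) / real (e + T + 1)" by (simp add: x_def field_simps)
    finally have "real (e + T + 1) ^ r \<le> 2 * real (e + 1) ^ r"
      by (simp add: power_divide field_simps)
    then show ?thesis by (metis (no_types) of_nat_le_iff of_nat_mult of_nat_numeral of_nat_power)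
  qed
  have "(T + 1) ^ c * (e + T + 1) ^ r \<le> (T + 1) ^ c * (2 * (e + 1) ^ r)"
    using 2 by (rule mult_le_mono2)
  also have "\<dots> = (2 * (T + 1) ^ c) * (e + 1) ^ r" by simp
  also have "\<dots> < (d + 1) ^ Suc c * (e + 1) ^ r"
    using 1 by (intro mult_strict_right_mono) simp_all
  finally show ?thesis using that[of d e] unfolding T_def by (simp add: add_ac)
qed

text \<open>Each exponent is bounded separately, instead of the total degree, so that the monomials
  in question form a box.\<close>

definition exponents_le :: "nat \<Rightarrow> ('v, 'k::field) mpoly \<Rightarrow> bool" where
  "exponents_le n f \<longleftrightarrow> (\<forall>m\<in>keys f. \<forall>v. lookup m v \<le> n)"

lemma exponents_le_mult:
  "exponents_le a f \<Longrightarrow> exponents_le b g \<Longrightarrow> exponents_le (a + b) (f * g)"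
  unfolding exponents_le_def using keys_mult[of f g] by (fastforce simp: lookup_add intro: add_mono)

lemma exponents_le_power: "exponents_le a f \<Longrightarrow> exponents_le (n * a) (f ^ n)"
proof (induction n)
  case 0
  show ?case by (simp add: exponents_le_def)
next
  case (Suc n)
  then show ?case using exponents_le_mult[of a f "n * a" "f ^ n"] by simp
qed

lemma exponents_le_prod:
  assumes "finite A" and "\<And>i. i \<in> A \<Longrightarrow> exponents_le a (f i)"
  shows "exponents_le (card A * a) (prod f A)"
  using assms
proof (induction A rule: finite_induct)
  case empty
  show ?case by (simp add: exponents_le_def)
next
  case (insert i A)
  then show ?case using exponents_le_mult[of a "f i" "card A * a" "prod f A"] by simp
qed

lemma exponents_le_mono: "exponents_le a f \<Longrightarrow> a \<le> b \<Longrightarrow> exponents_le b f"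
  unfolding exponents_le_def by (meson order.trans)

lemma ex_exponents_le:
  fixes f :: "('v::finite, 'k::field) mpoly"
  shows "\<exists>n. exponents_le n f"
proof -
  have "exponents_le (\<Sum>m\<in>keys f. \<Sum>v\<in>UNIV. lookup m v) f"
    unfolding exponents_le_def
  proof (intro ballI allI)
    fix m v assume m: "m \<in> keys f"
    have "lookup m v \<le> (\<Sum>v\<in>UNIV. lookup m v)" by (rule member_le_sum) auto
    also have "\<dots> \<le> (\<Sum>m\<in>keys f. \<Sum>v\<in>UNIV. lookup m v)"
      using m by (intro member_le_sum) auto
    finally show "lookup m v \<le> (\<Sum>m\<in>keys f. \<Sum>v\<in>UNIV. lookup m v)" .
  qed
  then show ?thesis ..
qed


text \<open>\<open>scale\<close> is a variable with an equation so that the lemma fits the scalar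
  multiplication defined locally in \<open>prime_chain_length_le\<close>.\<close>

lemma mem_span_monomials:
  fixes f :: "('v, 'k::field) mpoly"
  assumes "vector_space scale" and "scale = (\<lambda>a f. Poly_Mapping.single 0 a * f)"
    and "keys f \<subseteq> M"
  shows "f \<in> module.span scale ((\<lambda>m. Poly_Mapping.single m 1) ` M)"
proof -
  interpret vector_space scale by fact
  have "f = (\<Sum>k\<in>keys f. scale (lookup f k) (Poly_Mapping.single k 1))"
    unfolding assms(2)
    by (rule poly_mapping_eqI) (auto simp: mult_single lookup_sum lookup_single when_def in_keys_iff)
  moreover have "(\<Sum>k\<in>keys f. scale (lookup f k) (Poly_Mapping.single k 1)) \<in>
      span ((\<lambda>m. Poly_Mapping.single m 1) ` M)"
    using assms(3) by (intro span_sum span_scale span_base) auto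
  ultimately show ?thesis by simp
qed

text \<open>
  Otherwise pick \<open>y i \<in> c (i + 1) - c i\<close> for \<open>i \<le> card C\<close>.  Counting monomials shows that these
  elements are algebraically dependent over the polynomials in the variables outside \<open>C\<close>.
\<close>

lemma prime_chain_length_le:
  fixes c :: "nat \<Rightarrow> ('v::finite, 'k::field) mpoly set"
  assumes prime: "\<And>i. i \<le> n \<Longrightarrow> primeideal (c i) ring_of_type_algebra"
    and chain: "\<And>i. i < n \<Longrightarrow> c i \<subset> c (Suc i)"
    and top: "c n = var_ideal C"
  shows "n \<le> card C"
proof (rule ccontr)
  assume "\<not> n \<le> card C"
  define m where "m = Suc (card C)"
  have "m \<le> n" using \<open>\<not> n \<le> card C\<close> by (simp add: m_def)
  have "c m \<subseteq> c j" if "m \<le> j" "j \<le> n" for j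
    using that
  proof (induction j rule: dec_induct)
    case (step j)
    then show ?case using chain[of j] by auto
  qed simp
  from this[of n] have cm: "c m \<subseteq> var_ideal C" using \<open>m \<le> n\<close> top by simp
  have "\<forall>i. \<exists>y. i < m \<longrightarrow> y \<in> c (Suc i) \<and> y \<notin> c i"
    using chain \<open>m \<le> n\<close> by (meson less_le_trans psubset_imp_ex_mem DiffE)
  then obtain y where y: "\<And>i. i < m \<Longrightarrow> y i \<in> c (Suc i) \<and> y i \<notin> c i" by metis
  obtain deg where deg: "\<And>i. exponents_le (deg i) (y i)"
    using ex_exponents_le[of "y _"] by metis
  define D where "D = (\<Sum>i<m. deg i)"
  have D: "exponents_le D (y i)" if "i < m" for i
    using deg by (rule exponents_le_mono) (use that in \<open>auto simp: D_def intro!: member_le_sum\<close>)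
  obtain d e where count: "(m * d * D + 1) ^ card C * (e + m * d * D + 1) ^ card (- C) <
      (d + 1) ^ m * (e + 1) ^ card (- C)"
    using exponent_counting[of "card C" D "card (- C)"] unfolding m_def by blast
  \<comment> \<open>\<open>A\<close> holds the exponents of the \<open>y i\<close>, \<open>N\<close>
    the coefficient monomials, which are free of \<open>C\<close>, and \<open>M\<close> is a box
    containing all monomials of the resulting products.\<close>
  define A where "A = ({..<m} \<rightarrow>\<^sub>E {..d})"
  define N where "N = {k :: 'v \<Rightarrow>\<^sub>0 nat. \<forall>v. lookup k v \<le> (if v \<in> C then 0 else e)}"
  define M where "M = {k :: 'v \<Rightarrow>\<^sub>0 nat. \<forall>v. lookup k v \<le> (if v \<in> C then m * d * D else e + m * d * D)}"
  have prod_split: "(\<Prod>v\<in>UNIV. Suc (if v \<in> C then a else b)) = Suc a ^ card C * Suc b ^ card (- C)"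
    for a b
  proof -
    have "(\<Prod>v\<in>UNIV. Suc (if v \<in> C then a else b)) = (\<Prod>v\<in>UNIV. if v \<in> C then Suc a else Suc b)"
      by (intro prod.cong) auto
    then show ?thesis by (simp add: prod.If_cases)
  qed
  have fin: "finite A" "finite N" "finite M"
    unfolding A_def N_def M_def by (intro finite_PiE card_exponent_box(1); simp)+
  have "card M = Suc (m * d * D) ^ card C * Suc (e + m * d * D) ^ card (- C)"
    unfolding M_def card_exponent_box(2) prod_split ..
  also have "\<dots> < card A * card N"
    unfolding A_def N_def card_exponent_box(2) prod_split using count by (simp add: card_PiE)
  finally have card: "card M < card (A \<times> N)" by (simp add: card_cartesian_product)
  define Y where "Y \<alpha> = (\<Prod>i<m. y i ^ \<alpha> i)" for \<alpha> :: "nat \<Rightarrow> nat"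
  define scale where "scale = (\<lambda>a f. Poly_Mapping.single 0 a * f :: ('v, 'k) mpoly)"
  interpret vector_space scale
    by unfold_locales
      (simp_all add: scale_def distrib_left distrib_right single_add mult_single flip: mult.assoc)
  define x where "x = (\<lambda>(\<alpha>, k). Poly_Mapping.single k 1 * Y \<alpha>)"
  have span: "x p \<in> span ((\<lambda>k. Poly_Mapping.single k 1) ` M)" if mem: "p \<in> A \<times> N" for p
  proof (rule mem_span_monomials[OF vector_space_axioms scale_def])
    obtain \<alpha> k where p: "p = (\<alpha>, k)" "\<alpha> \<in> A" "k \<in> N" using mem by auto
    have "exponents_le (d * D) (y i ^ \<alpha> i)" if "i < m" for i
    proof -
      have "exponents_le (\<alpha> i * D) (y i ^ \<alpha> i)" using D[OF that] by (rule exponents_le_power)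
      moreover have "\<alpha> i \<le> d" using p(2) that by (auto simp: A_def)
      ultimately show ?thesis by (meson exponents_le_mono mult_le_mono1)
    qed
    then have Y: "exponents_le (m * d * D) (Y \<alpha>)"
      unfolding Y_def using exponents_le_prod[of "{..<m}" "d * D" "\<lambda>i. y i ^ \<alpha> i"]
      by (simp add: mult.assoc)
    show "keys (x p) \<subseteq> M"
    proof
      fix l assume "l \<in> keys (x p)"
      then obtain l' where l: "l = k + l'" "l' \<in> keys (Y \<alpha>)"
        using keys_mult[of "Poly_Mapping.single k 1" "Y \<alpha>"] by (auto simp: x_def p(1))
      have "lookup k v \<le> (if v \<in> C then 0 else e)" "lookup l' v \<le> m * d * D" for v
        using p(3) Y l(2) by (auto simp: N_def exponents_le_def)
      from add_mono[OF this]
      have "lookup k v + lookup l' v \<le> (if v \<in> C then m * d * D else e + m * d * D)" for v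
        by (cases "v \<in> C") (metis add_0, metis)
      then have "\<forall>v. lookup l v \<le> (if v \<in> C then m * d * D else e + m * d * D)"
        unfolding l(1) lookup_add by (rule allI)
      then show "l \<in> M" by (simp add: M_def)
    qed
  qed
  have card_span: "card ((\<lambda>k. Poly_Mapping.single k (1::'k)) ` M) < card (A \<times> N)"
    using card_image_le[OF fin(3)] card by (rule le_less_trans)
  obtain u where u: "\<exists>p\<in>A \<times> N. u p \<noteq> 0" "(\<Sum>p\<in>A \<times> N. scale (u p) (x p)) = 0"
    by (rule linear_relation_of_span
        [OF finite_imageI[OF fin(3)] finite_cartesian_product[OF fin(1,2)] card_span span])
  \<comment> \<open>The scalar relation is regrouped by \<open>\<alpha>\<close>. The coefficients
    \<open>b \<alpha>\<close> involve only variables outside \<open>C\<close>, so the nonzero ones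
    avoid \<open>var_ideal C\<close> and hence \<open>c m\<close>.\<close>
  define b where "b \<alpha> = (\<Sum>k\<in>N. Poly_Mapping.single k (u (\<alpha>, k)))" for \<alpha>
  have lookup_b: "lookup (b \<alpha>) k = (if k \<in> N then u (\<alpha>, k) else 0)" for \<alpha> k
    using fin(2) by (simp add: b_def lookup_sum lookup_single when_def sum.delta)
  define E where "E = {\<alpha>\<in>A. b \<alpha> \<noteq> 0}"
  have "0 = (\<Sum>\<alpha>\<in>A. \<Sum>k\<in>N. scale (u (\<alpha>, k)) (x (\<alpha>, k)))"
    using u(2) by (simp add: sum.cartesian_product)
  also have "\<dots> = (\<Sum>\<alpha>\<in>A. b \<alpha> * Y \<alpha>)"
    by (simp add: scale_def x_def b_def sum_distrib_right mult_single flip: mult.assoc)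
  also have "\<dots> = (\<Sum>\<alpha>\<in>E. b \<alpha> * Y \<alpha>)"
    by (rule sum.mono_neutral_right) (use fin(1) in \<open>auto simp: E_def\<close>)
  finally have rel: "(\<Sum>\<alpha>\<in>E. b \<alpha> * Y \<alpha>) = 0" by simp
  have "(\<Sum>\<alpha>\<in>E. b \<alpha> * (\<Prod>i<m. y i ^ \<alpha> i)) \<notin> c 0"
  proof (rule prime_chain_no_relation)
    show "finite E" using fin(1) by (simp add: E_def)
    show "E \<subseteq> {..<m} \<rightarrow>\<^sub>E UNIV" by (auto simp: E_def A_def)
    obtain \<alpha> k where "\<alpha> \<in> A" "k \<in> N" "u (\<alpha>, k) \<noteq> 0" using u(1) by auto
    then have "lookup (b \<alpha>) k \<noteq> 0" by (simp add: lookup_b)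
    then have "b \<alpha> \<noteq> 0" by auto
    with \<open>\<alpha> \<in> A\<close> show "E \<noteq> {}" by (auto simp: E_def)
  next
    fix \<alpha> assume "\<alpha> \<in> E"
    then obtain k where k: "k \<in> keys (b \<alpha>)"
      by (auto simp: E_def simp flip: keys_eq_empty)
    then have "k \<in> N" by (auto simp: in_keys_iff lookup_b split: if_splits)
    then have "\<forall>v\<in>C. lookup k v = 0"
      unfolding N_def by (metis (mono_tags, lifting) le_zero_eq mem_Collect_eq)
    with k have "b \<alpha> \<notin> var_ideal C" by (auto simp: var_ideal_def)
    with cm show "b \<alpha> \<notin> c m" by blast
  qed (use prime chain y \<open>m \<le> n\<close> in \<open>auto simp: psubset_imp_subset\<close>)
  moreover have "0 \<in> c 0"
    using prime[of 0] primeideal_imp_ideal ideal_ring_of_type_algebra_iff by blast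
  ultimately show False using rel by (simp add: Y_def)
qed

text \<open>\<open>prime_chain_length_le\<close> bounds the height from above; adjoining the
  variables of \<open>C\<close> one at a time attains the bound.\<close>

lemma prime_height_var_ideal:
  "prime_height ring_of_type_algebra (var_ideal C :: ('v::finite, 'k::field) mpoly set) = enat (card C)"
proof (rule antisym)
  show "prime_height ring_of_type_algebra (var_ideal C :: ('v, 'k) mpoly set) \<le> enat (card C)"
    unfolding prime_height_def
  proof (rule Sup_least, clarify)
    fix n and c :: "nat \<Rightarrow> ('v, 'k) mpoly set"
    assume "\<forall>i\<le>n. primeideal (c i) ring_of_type_algebra" "\<forall>i<n. c i \<subset> c (Suc i)" "c n = var_ideal C"
    then show "enat n \<le> enat (card C)"
      using prime_chain_length_le[of n c C] by simp
  qed
next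
  obtain h where h: "bij_betw h {..<card C} C"
    using ex_bij_betw_nat_finite[of C] by (auto simp: atLeast0LessThan)
  define c :: "nat \<Rightarrow> ('v, 'k) mpoly set" where "c i = var_ideal (h ` {..<i})" for i
  have "c i \<subset> c (Suc i)" if "i < card C" for i
  proof
    have "h ` {..<i} \<subseteq> h ` {..<Suc i}" by auto
    then show "c i \<subseteq> c (Suc i)" unfolding c_def var_ideal_def by blast
    have "h i \<noteq> h j" if "j < i" for j
      using h \<open>i < card C\<close> that by (metis bij_betw_def inj_on_contraD lessThan_iff less_imp_neq less_trans)
    then have "h i \<notin> h ` {..<i}" by auto
    then have "(var (h i) :: ('v, 'k) mpoly) \<in> c (Suc i) - c i"
      by (auto simp: c_def var_in_var_ideal_iff)
    then show "c i \<noteq> c (Suc i)" by blast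
  qed
  moreover have "c (card C) = var_ideal C"
    using h by (simp add: c_def bij_betw_def)
  ultimately have "\<exists>c. (\<forall>i\<le>card C. primeideal (c i) ring_of_type_algebra) \<and>
      (\<forall>i<card C. c i \<subset> c (Suc i)) \<and> c (card C) = (var_ideal C :: ('v, 'k) mpoly set)"
    by (intro exI[of _ c]) (auto simp: c_def primeideal_var_ideal)
  then show "enat (card C) \<le> prime_height ring_of_type_algebra (var_ideal C :: ('v, 'k) mpoly set)"
    unfolding prime_height_def by (intro Sup_upper) blast
qed

lemma unmixed_edge_ideal_iff:
  "unmixed ring_of_type_algebra (edge_ideal H :: ('v::finite, 'k::field) mpoly set) \<longleftrightarrow>
    (\<forall>C D. minimal_cover H C \<longrightarrow> minimal_cover H D \<longrightarrow> card C = card D)"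
  by (auto simp: unmixed_def associated_primes_edge_ideal prime_height_var_ideal)

section \<open>Order-preserving maps between finite posets\<close>

text \<open>\<open>f\<close> preserves the set of \<open>z\<close> with \<open>z \<le> f z\<close>,
  so a maximal element of it is fixed; dually for \<open>f z \<le> z\<close>.\<close>

lemma mono_on_fixpoint:
  fixes f :: "'a::{finite,order} \<Rightarrow> 'a"
  assumes f: "mono_on A f" "f ` A \<subseteq> A" and x: "x \<in> A" "x \<le> f x \<or> f x \<le> x"
  shows "\<exists>x\<in>A. f x = x"
  using x(2)
proof
  assume "x \<le> f x"
  then obtain m where m: "m \<in> {z\<in>A. z \<le> f z}" "\<forall>b\<in>{z\<in>A. z \<le> f z}. m \<le> b \<longrightarrow> m = b"
    using finite_has_maximal[of "{z\<in>A. z \<le> f z}"] x(1) by auto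
  then have "f m \<in> {z\<in>A. z \<le> f z}"
    using f by (auto dest: mono_onD)
  with m show ?thesis by (metis (mono_tags, lifting) mem_Collect_eq)
next
  assume "f x \<le> x"
  then obtain m where m: "m \<in> {z\<in>A. f z \<le> z}" "\<forall>b\<in>{z\<in>A. f z \<le> z}. b \<le> m \<longrightarrow> m = b"
    using finite_has_minimal[of "{z\<in>A. f z \<le> z}"] x(1) by auto
  then have "f m \<in> {z\<in>A. f z \<le> z}"
    using f by (auto dest: mono_onD)
  with m show ?thesis by (metis (mono_tags, lifting) mem_Collect_eq)
qed

definition fixpoint_property :: "'a::order set \<Rightarrow> bool" where
  "fixpoint_property A \<longleftrightarrow> (\<forall>f. mono_on A f \<longrightarrow> f ` A \<subseteq> A \<longrightarrow> (\<exists>x\<in>A. f x = x))"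

text \<open>An element comparable with all of \<open>A\<close> is comparable with its own image,
  where \<open>mono_on_fixpoint\<close> can start.\<close>

lemma fixpoint_propertyI:
  fixes A :: "'a::{finite,order} set"
  assumes "r \<in> A" and "\<And>x. x \<in> A \<Longrightarrow> r \<le> x \<or> x \<le> r"
  shows "fixpoint_property A"
  unfolding fixpoint_property_def
proof (intro allI impI)
  fix f assume f: "mono_on A f" "f ` A \<subseteq> A"
  then have "f r \<in> A" using assms(1) by blast
  then show "\<exists>x\<in>A. f x = x"
    using mono_on_fixpoint[OF f assms(1)] assms(2) by blast
qed

text \<open>\<open>\<phi>\<close> and \<open>\<psi>\<close> exchange the fixed points of the two
  composites, so either set may supply one.\<close>

lemma fixpoint_property_comp:
  assumes "fixpoint_property A \<or> fixpoint_property B"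
    and \<phi>: "mono_on A \<phi>" "\<phi> ` A \<subseteq> B" and \<psi>: "mono_on B \<psi>" "\<psi> ` B \<subseteq> A"
  shows "\<exists>x\<in>A. \<psi> (\<phi> x) = x"
proof -
  have "mono_on A (\<psi> \<circ> \<phi>)" "(\<psi> \<circ> \<phi>) ` A \<subseteq> A" "mono_on B (\<phi> \<circ> \<psi>)" "(\<phi> \<circ> \<psi>) ` B \<subseteq> B"
    using \<phi> \<psi> by (auto simp: mono_on_def image_subset_iff)
  with assms(1) have "(\<exists>x\<in>A. (\<psi> \<circ> \<phi>) x = x) \<or> (\<exists>y\<in>B. (\<phi> \<circ> \<psi>) y = y)"
    unfolding fixpoint_property_def by blast
  then show ?thesis using \<psi>(2) by (auto simp: image_subset_iff) (metis)
qed

text \<open>A cover \<open>C\<close> of the graphs of monotone maps enters as \<open>N x y \<longleftrightarrow> (x, y) \<notin> C\<close>.\<close>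

definition dichotomy :: "'p::order set \<Rightarrow> 'q::order set \<Rightarrow> bool" where
  "dichotomy A B \<longleftrightarrow> (\<forall>N.
     (\<exists>\<phi>. mono_on A \<phi> \<and> \<phi> ` A \<subseteq> B \<and> (\<forall>x\<in>A. N x (\<phi> x))) \<or>
     (\<exists>\<psi>. mono_on B \<psi> \<and> \<psi> ` B \<subseteq> A \<and> (\<forall>y\<in>B. \<not> N (\<psi> y) y)))"

text \<open>Replacing \<open>N\<close> by its negated transpose exchanges the two
  alternatives.\<close>

lemma dichotomy_sym: "dichotomy A B \<Longrightarrow> dichotomy B A"
  unfolding dichotomy_def
proof
  fix N assume "\<forall>N. (\<exists>\<phi>. mono_on A \<phi> \<and> \<phi> ` A \<subseteq> B \<and> (\<forall>x\<in>A. N x (\<phi> x))) \<or>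
     (\<exists>\<psi>. mono_on B \<psi> \<and> \<psi> ` B \<subseteq> A \<and> (\<forall>y\<in>B. \<not> N (\<psi> y) y))"
  from spec[OF this, of "\<lambda>x y. \<not> N y x"]
  show "(\<exists>\<phi>. mono_on B \<phi> \<and> \<phi> ` B \<subseteq> A \<and> (\<forall>x\<in>B. N x (\<phi> x))) \<or>
     (\<exists>\<psi>. mono_on A \<psi> \<and> \<psi> ` A \<subseteq> B \<and> (\<forall>y\<in>A. \<not> N (\<psi> y) y))" by auto
qed

text \<open>
  \<open>\<psi> y\<close> is the first element of the chain at which a monotone map with graph in \<open>N\<close> and values below
  \<open>y\<close> can no longer be continued.
\<close>

lemma dichotomy_chain:
  fixes A :: "'p::{finite,order} set" and B :: "'q::order set"
  assumes chain: "\<forall>x\<in>A. \<forall>y\<in>A. x \<le> y \<or> y \<le> x"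
  shows "dichotomy A B"
  unfolding dichotomy_def
proof
  fix N :: "'p \<Rightarrow> 'q \<Rightarrow> bool"
  define G where "G x y \<longleftrightarrow> (\<exists>\<phi>. mono_on {a\<in>A. a \<le> x} \<phi> \<and>
    (\<forall>a\<in>A. a \<le> x \<longrightarrow> \<phi> a \<in> B \<and> \<phi> a \<le> y \<and> N a (\<phi> a)))" for x y
  show "(\<exists>\<phi>. mono_on A \<phi> \<and> \<phi> ` A \<subseteq> B \<and> (\<forall>x\<in>A. N x (\<phi> x))) \<or>
     (\<exists>\<psi>. mono_on B \<psi> \<and> \<psi> ` B \<subseteq> A \<and> (\<forall>y\<in>B. \<not> N (\<psi> y) y))"
  proof (cases "A = {} \<or> (\<exists>y\<in>B. \<forall>x\<in>A. G x y)")
    case True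
    then show ?thesis
    proof
      assume "A = {}"
      then show ?thesis by (auto simp: mono_on_def)
    next
      assume "\<exists>y\<in>B. \<forall>x\<in>A. G x y"
      then obtain y where y: "\<forall>x\<in>A. G x y" by blast
      show ?thesis
      proof (cases "A = {}")
        case False
        then obtain t where "t \<in> A" "\<forall>b\<in>A. t \<le> b \<longrightarrow> t = b"
          using finite_has_maximal[of A] by auto
        then have t: "t \<in> A" "\<forall>a\<in>A. a \<le> t" using chain by blast+
        then have "{a\<in>A. a \<le> t} = A" by blast
        moreover have "G t y" using t(1) y by blast
        ultimately show ?thesis using t(2) unfolding G_def by auto
      qed (auto simp: mono_on_def)
    qed
  next
    case False
    have "\<exists>x\<in>A. \<not> G x y \<and> (\<forall>x'\<in>A. \<not> G x' y \<longrightarrow> x \<le> x')" if "y \<in> B" for y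
    proof -
      have "{x\<in>A. \<not> G x y} \<noteq> {}" using False that by blast
      then obtain x where "x \<in> {x\<in>A. \<not> G x y}" "\<forall>b\<in>{x\<in>A. \<not> G x y}. b \<le> x \<longrightarrow> x = b"
        using finite_has_minimal[of "{x\<in>A. \<not> G x y}"] by auto
      then show ?thesis using chain by blast
    qed
    then obtain \<psi> where \<psi>: "\<And>y. y \<in> B \<Longrightarrow> \<psi> y \<in> A \<and> \<not> G (\<psi> y) y"
      and least: "\<And>y x. y \<in> B \<Longrightarrow> x \<in> A \<Longrightarrow> \<not> G x y \<Longrightarrow> \<psi> y \<le> x"
      by metis
    have "mono_on B \<psi>"
    proof (rule mono_onI)
      fix y y' assume y: "y \<in> B" "y' \<in> B" "y \<le> y'"
      \<comment> \<open>A larger bound admits more maps, so the first failure can only move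
        up.\<close>
      have "G x y \<Longrightarrow> G x y'" for x
        unfolding G_def using y(3) by (meson order.trans)
      then show "\<psi> y \<le> \<psi> y'" using \<psi> least y by blast
    qed
    moreover have "\<not> N (\<psi> y) y" if y: "y \<in> B" for y
    proof
      assume N: "N (\<psi> y) y"
      define x where "x = \<psi> y"
      have x: "x \<in> A" "\<not> G x y" "N x y" using \<psi>[OF y] N by (auto simp: x_def)
      have below: "G a y" if "a \<in> A" "a < x" for a
        using least[OF y that(1)] that(2) leD unfolding x_def by blast
      have "\<exists>\<phi>. mono_on {a\<in>A. a < x} \<phi> \<and> (\<forall>a\<in>A. a < x \<longrightarrow> \<phi> a \<in> B \<and> \<phi> a \<le> y \<and> N a (\<phi> a))"
      proof (cases "{a\<in>A. a < x} = {}")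
        case True
        then show ?thesis by (auto simp: mono_on_def)
      next
        case False
        then obtain t where "t \<in> {a\<in>A. a < x}" "\<forall>b\<in>{a\<in>A. a < x}. t \<le> b \<longrightarrow> t = b"
          using finite_has_maximal[of "{a\<in>A. a < x}"] by auto
        then have t: "t \<in> A" "t < x" "\<And>a. a \<in> A \<Longrightarrow> a < x \<Longrightarrow> a \<le> t"
          using chain by blast+
        then have "{a\<in>A. a < x} = {a\<in>A. a \<le> t}" by auto
        then show ?thesis using below[OF t(1,2)] unfolding G_def by auto
      qed
      then obtain \<phi> where \<phi>: "mono_on {a\<in>A. a < x} \<phi>"
        "\<And>a. a \<in> A \<Longrightarrow> a < x \<Longrightarrow> \<phi> a \<in> B \<and> \<phi> a \<le> y \<and> N a (\<phi> a)" by blast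
      \<comment> \<open>All earlier values are at most \<open>y\<close> and \<open>N x y\<close>
        holds, so the value \<open>y\<close> at \<open>x\<close> continues the map, contrary to the
        choice of \<open>x\<close>.\<close>
      have "mono_on {a\<in>A. a \<le> x} (\<phi>(x := y))"
      proof (rule mono_onI)
        fix a b assume ab: "a \<in> {a\<in>A. a \<le> x}" "b \<in> {a\<in>A. a \<le> x}" "a \<le> b"
        show "(\<phi>(x := y)) a \<le> (\<phi>(x := y)) b"
        proof (cases "b = x")
          case True
          then show ?thesis using ab \<phi>(2)[of a] by (auto simp: less_le)
        next
          case False
          then have "b < x" "a < x" using ab by (auto simp: less_le)
          then show ?thesis using ab mono_onD[OF \<phi>(1), of a b] by auto
        qed
      qed
      moreover have "(\<phi>(x := y)) a \<in> B \<and> (\<phi>(x := y)) a \<le> y \<and> N a ((\<phi>(x := y)) a)"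
        if "a \<in> A" "a \<le> x" for a
        using that \<phi>(2)[of a] x y by (auto simp: less_le)
      ultimately have "G x y" unfolding G_def by blast
      with x(2) show False ..
    qed
    ultimately show ?thesis using \<psi> by (intro disjI2 exI[of _ \<psi>]) auto
  qed
qed

text \<open>
  The next lemmas are stated for arbitrary partial orders \<open>R\<close> and \<open>S\<close> so that they apply both to
  the orders of the types and to their duals.
\<close>

definition cone_map :: "('a \<Rightarrow> 'a \<Rightarrow> bool) \<Rightarrow> ('b \<Rightarrow> 'b \<Rightarrow> bool) \<Rightarrow> ('a \<Rightarrow> 'b \<Rightarrow> bool) \<Rightarrow> 'a \<Rightarrow> 'b \<Rightarrow> bool"
  where "cone_map R S N p q \<longleftrightarrow>
    (\<exists>\<phi>. monotone_on {x. R p x} R S \<phi> \<and> (\<forall>x. R p x \<longrightarrow> S q (\<phi> x) \<and> N x (\<phi> x)))"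

definition forest :: "('a \<Rightarrow> 'a \<Rightarrow> bool) \<Rightarrow> bool" where
  "forest R \<longleftrightarrow> reflp R \<and> antisymp R \<and> transp R \<and> (\<forall>x y z. R x z \<longrightarrow> R y z \<longrightarrow> R x y \<or> R y x)"

lemma cone_map_weaken:
  assumes "transp S" and "S q q'" and "cone_map R S N p q'"
  shows "cone_map R S N p q"
proof -
  obtain \<phi> where "monotone_on {x. R p x} R S \<phi>" "\<forall>x. R p x \<longrightarrow> S q' (\<phi> x) \<and> N x (\<phi> x)"
    using assms(3) unfolding cone_map_def by blast
  then show ?thesis
    unfolding cone_map_def using transpD[OF assms(1,2)] by blast
qed

text \<open>The elements strictly above \<open>p\<close> and below \<open>x\<close> form a chain;
  its least element, found by minimizing the number of predecessors, is the child of
  \<open>p\<close> leading to \<open>x\<close>.\<close>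

lemma forest_child:
  fixes R :: "'a::finite \<Rightarrow> 'a \<Rightarrow> bool"
  assumes "forest R" and "R p x" and "x \<noteq> p"
  shows "\<exists>z. R p z \<and> z \<noteq> p \<and> R z x \<and> (\<forall>w. R p w \<longrightarrow> w \<noteq> p \<longrightarrow> R w x \<longrightarrow> R z w)"
proof -
  have R: "reflp R" "antisymp R" "transp R" and lin: "\<And>x y z. R x z \<Longrightarrow> R y z \<Longrightarrow> R x y \<or> R y x"
    using assms(1) unfolding forest_def by blast+
  let ?P = "\<lambda>z. R p z \<and> z \<noteq> p \<and> R z x"
  have "?P x" using assms(2,3) R(1) by (auto dest: reflpD)
  then obtain z where z: "?P z" "\<And>w. ?P w \<Longrightarrow> card {v. R v z} \<le> card {v. R v w}"
    using ex_has_least_nat[of ?P x "\<lambda>z. card {v. R v z}"] by blast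
  have "R z w" if w: "?P w" for w
  proof (rule ccontr)
    assume "\<not> R z w"
    with lin w z(1) have "R w z" by blast
    then have "{v. R v w} \<subset> {v. R v z}"
      using \<open>\<not> R z w\<close> R(1) transpD[OF R(3)] by (auto dest: reflpD)
    then have "card {v. R v w} < card {v. R v z}" by (intro psubset_card_mono) auto
    with z(2)[OF w] show False by simp
  qed
  with z(1) show ?thesis by blast
qed

text \<open>Without its root, the cone over \<open>p\<close> splits into unrelated cones over the
  children of \<open>p\<close>. Maps on these glue, and the root receives \<open>q\<close>, which
  lies below all other values.\<close>

lemma cone_map_step:
  fixes R :: "'a::finite \<Rightarrow> 'a \<Rightarrow> bool"
  assumes "forest R" and S: "reflp S" and "N p q"
    and sub: "\<And>p'. R p p' \<Longrightarrow> p' \<noteq> p \<Longrightarrow> cone_map R S N p' q"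
  shows "cone_map R S N p q"
proof -
  have R: "reflp R" "antisymp R" "transp R"
    using assms(1) unfolding forest_def by blast+
  have "\<forall>x. \<exists>z. R p x \<longrightarrow> x \<noteq> p \<longrightarrow>
      R p z \<and> z \<noteq> p \<and> R z x \<and> (\<forall>w. R p w \<longrightarrow> w \<noteq> p \<longrightarrow> R w x \<longrightarrow> R z w)"
    using forest_child[OF assms(1)] by meson
  then obtain ch where ch: "\<And>x. R p x \<Longrightarrow> x \<noteq> p \<Longrightarrow> R p (ch x) \<and> ch x \<noteq> p \<and> R (ch x) x"
    and ch_least: "\<And>x w. R p x \<Longrightarrow> x \<noteq> p \<Longrightarrow> R p w \<Longrightarrow> w \<noteq> p \<Longrightarrow> R w x \<Longrightarrow> R (ch x) w"
    by metis
  have ch_eq: "ch x = ch y" if x: "R p x" "x \<noteq> p" and y: "R x y" for x y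
  proof -
    have y': "R p y" "y \<noteq> p"
      using x y transpD[OF R(3)] antisympD[OF R(2)] by blast+
    have "R (ch x) y" using ch[OF x] y transpD[OF R(3)] by blast
    then have "R (ch y) (ch x)" using ch_least[OF y'] ch[OF x] by blast
    moreover have "R (ch y) x" using ch_least[OF y' x y] .
    then have "R (ch x) (ch y)" using ch_least[OF x] ch[OF y'] by blast
    ultimately show ?thesis using antisympD[OF R(2)] by blast
  qed
  obtain \<Phi> where \<Phi>: "\<And>p'. R p p' \<Longrightarrow> p' \<noteq> p \<Longrightarrow> monotone_on {x. R p' x} R S (\<Phi> p') \<and>
      (\<forall>x. R p' x \<longrightarrow> S q (\<Phi> p' x) \<and> N x (\<Phi> p' x))"
    using sub unfolding cone_map_def by metis
  define \<phi> where "\<phi> x = (if x = p then q else \<Phi> (ch x) x)" for x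
  have val: "S q (\<phi> x) \<and> N x (\<phi> x)" if "R p x" for x
  proof (cases "x = p")
    case True
    then show ?thesis using S assms(3) by (auto simp: \<phi>_def dest: reflpD)
  next
    case False
    then show ?thesis using ch[OF that] \<Phi> by (simp add: \<phi>_def)
  qed
  have "monotone_on {x. R p x} R S \<phi>"
  proof (rule monotone_onI)
    fix x y assume xy: "x \<in> {x. R p x}" "y \<in> {x. R p x}" "R x y"
    show "S (\<phi> x) (\<phi> y)"
    proof (cases "x = p")
      case True
      then show ?thesis using val[of y] xy by (simp add: \<phi>_def)
    next
      case False
      then have "y \<noteq> p" using xy antisympD[OF R(2)] by auto
      have "R (ch x) x" "R (ch x) y" "monotone_on {z. R (ch x) z} R S (\<Phi> (ch x))"
        using ch[of x] \<Phi>[of "ch x"] False xy transpD[OF R(3), of "ch x" x y] by simp_all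
      then have "S (\<Phi> (ch x) x) (\<Phi> (ch x) y)"
        using xy(3) by (auto dest: monotone_onD)
      then show ?thesis using False \<open>y \<noteq> p\<close> ch_eq[of x y] xy by (simp add: \<phi>_def)
    qed
  qed
  with val show ?thesis unfolding cone_map_def by blast
qed

text \<open>If \<open>N p q\<close>, induction applies to \<open>q\<close> and each proper subcone
  of \<open>p\<close>: either all these maps exist and extend to \<open>p\<close>, or a reverse map
  into some subcone is also one into the cone of \<open>p\<close>. If \<open>N p q\<close> fails,
  the two sides change roles.\<close>

lemma cone_map_dichotomy:
  fixes R :: "'a::finite \<Rightarrow> 'a \<Rightarrow> bool" and S :: "'b::finite \<Rightarrow> 'b \<Rightarrow> bool"
  assumes R: "forest R" and S: "forest S"
  shows "cone_map R S N p q \<or> cone_map S R (\<lambda>y x. \<not> N x y) q p"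
proof (induction "card {x. R p x} + card {y. S q y}" arbitrary: p q rule: less_induct)
  case less
  have smaller: "card {x. T a' x} < card {x. T a x}" if "forest T" "T a a'" "a' \<noteq> a"
    for T :: "'c::finite \<Rightarrow> 'c \<Rightarrow> bool" and a a'
  proof (rule psubset_card_mono)
    show "{x. T a' x} \<subset> {x. T a x}"
    proof (rule psubsetI)
      have T: "reflp T" "antisymp T" "transp T" using that(1) by (simp_all add: forest_def)
      show "{x. T a' x} \<subseteq> {x. T a x}" using transpD[OF T(3) that(2)] by blast
      show "{x. T a' x} \<noteq> {x. T a x}"
        using reflpD[OF T(1), of a] antisympD[OF T(2) _ that(2)] that(3) by blast
    qed
  qed simp
  have refl_trans: "reflp R" "transp R" "reflp S" "transp S"
    using R S by (auto simp: forest_def)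
  show ?case
  proof (cases "N p q")
    case True
    show ?thesis
    proof (rule ccontr)
      assume *: "\<not> ?thesis"
      have "cone_map R S N p' q" if "R p p'" "p' \<noteq> p" for p'
        using less(1)[of p' q] smaller[OF R that] *
          cone_map_weaken[OF refl_trans(2) that(1), where R = S and N = "\<lambda>y x. \<not> N x y" and p = q]
        by auto
      then show False using cone_map_step[OF R refl_trans(3), of N p q] True * by blast
    qed
  next
    case False
    show ?thesis
    proof (rule ccontr)
      assume *: "\<not> ?thesis"
      have "cone_map S R (\<lambda>y x. \<not> N x y) q' p" if "S q q'" "q' \<noteq> q" for q'
        using less(1)[of p q'] smaller[OF S that] *
          cone_map_weaken[OF refl_trans(4) that(1), where R = R and N = N and p = p]
        by auto
      then show False
        using cone_map_step[OF S refl_trans(1), of "\<lambda>y x. \<not> N x y" q p] False * by blast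
    qed
  qed
qed

lemma monotone_on_dual: "monotone_on A (\<ge>) (\<ge>) f \<longleftrightarrow> mono_on A f"
  for f :: "'a::order \<Rightarrow> 'b::order"
  by (rule iffI; rule monotone_onI; erule monotone_onD; assumption)

lemma dichotomy_forest:
  fixes p :: "'p::{finite,order}" and q :: "'q::{finite,order}"
  assumes "forest ((\<le>) :: 'p \<Rightarrow> _)" and "forest ((\<le>) :: 'q \<Rightarrow> _)"
  shows "dichotomy {x. p \<le> x} {y. q \<le> y}"
  unfolding dichotomy_def
proof
  fix N
  show "(\<exists>\<phi>. mono_on {x. p \<le> x} \<phi> \<and> \<phi> ` {x. p \<le> x} \<subseteq> {y. q \<le> y} \<and> (\<forall>x\<in>{x. p \<le> x}. N x (\<phi> x))) \<or>
    (\<exists>\<psi>. mono_on {y. q \<le> y} \<psi> \<and> \<psi> ` {y. q \<le> y} \<subseteq> {x. p \<le> x} \<and> (\<forall>y\<in>{y. q \<le> y}. \<not> N (\<psi> y) y))"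
    using cone_map_dichotomy[OF assms, of N p q] unfolding cone_map_def by blast
qed

lemma dichotomy_dual_forest:
  fixes p :: "'p::{finite,order}" and q :: "'q::{finite,order}"
  assumes "forest ((\<ge>) :: 'p \<Rightarrow> _)" and "forest ((\<ge>) :: 'q \<Rightarrow> _)"
  shows "dichotomy {x. x \<le> p} {y. y \<le> q}"
  unfolding dichotomy_def
proof
  fix N
  show "(\<exists>\<phi>. mono_on {x. x \<le> p} \<phi> \<and> \<phi> ` {x. x \<le> p} \<subseteq> {y. y \<le> q} \<and> (\<forall>x\<in>{x. x \<le> p}. N x (\<phi> x))) \<or>
    (\<exists>\<psi>. mono_on {y. y \<le> q} \<psi> \<and> \<psi> ` {y. y \<le> q} \<subseteq> {x. x \<le> p} \<and> (\<forall>y\<in>{y. y \<le> q}. \<not> N (\<psi> y) y))"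
    using cone_map_dichotomy[OF assms, of N p q] unfolding cone_map_def monotone_on_dual by blast
qed

lemma forest_le_iff_rooted: "forest ((\<le>) :: 'p::order \<Rightarrow> _) \<longleftrightarrow> rooted TYPE('p)"
proof
  assume "forest ((\<le>) :: 'p \<Rightarrow> _)"
  then show "rooted TYPE('p)"
    by (auto simp: forest_def rooted_def incomparable_def dest: less_imp_le)
next
  assume "rooted TYPE('p)"
  then have "x \<le> y \<or> y \<le> x" if "x \<le> z" "y \<le> z" for x y z :: 'p
    using that unfolding rooted_def incomparable_def by (metis order.order_iff_strict)
  then show "forest ((\<le>) :: 'p \<Rightarrow> _)"
    by (auto simp: forest_def intro: reflpI antisympI transpI)
qed

lemma forest_ge_iff_co_rooted: "forest ((\<ge>) :: 'p::order \<Rightarrow> _) \<longleftrightarrow> co_rooted TYPE('p)"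
proof
  assume "forest ((\<ge>) :: 'p \<Rightarrow> _)"
  then show "co_rooted TYPE('p)"
    by (auto simp: forest_def co_rooted_def incomparable_def dest: less_imp_le)
next
  assume "co_rooted TYPE('p)"
  then have "x \<le> y \<or> y \<le> x" if "z \<le> x" "z \<le> y" for x y z :: 'p
    using that unfolding co_rooted_def incomparable_def by (metis order.order_iff_strict)
  then show "forest ((\<ge>) :: 'p \<Rightarrow> _)"
    by (auto simp: forest_def intro: reflpI antisympI transpI)
qed

section \<open>Connected components\<close>

lemma self_in_hasse_component: "x \<in> hasse_component x"
  by (simp add: hasse_component_def)

lemma hasse_component_eq:
  assumes "y \<in> hasse_component x"
  shows "hasse_component y = hasse_component x"
proof -
  have "symp (hasse_adjacent :: 'a \<Rightarrow> _)" by (auto simp: hasse_adjacent_def intro: sympI)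
  then have "symp (hasse_adjacent :: 'a \<Rightarrow> _)\<^sup>*\<^sup>*" by (rule symp_rtranclp)
  then have "hasse_adjacent\<^sup>*\<^sup>* y x" using assms by (auto simp: hasse_component_def dest: sympD)
  with assms show ?thesis by (auto simp: hasse_component_def intro: rtranclp_trans)
qed

text \<open>A minimal element of the interval strictly above \<open>x\<close> and up to
  \<open>y\<close> covers \<open>x\<close>; induction on interval size climbs to
  \<open>y\<close>.\<close>

lemma le_imp_hasse_component_eq:
  fixes x y :: "'a::{finite,order}"
  assumes "x \<le> y"
  shows "hasse_component x = hasse_component y"
proof -
  have "y \<in> hasse_component x" using assms
  proof (induction "card {z. x \<le> z \<and> z \<le> y}" arbitrary: x rule: less_induct)
    case less
    show ?case
    proof (cases "x = y")
      case False
      then have "y \<in> {z. x < z \<and> z \<le> y}" using less(2) by auto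
      then obtain z where z: "x < z" "z \<le> y" and min: "\<forall>b\<in>{z. x < z \<and> z \<le> y}. b \<le> z \<longrightarrow> z = b"
        using finite_has_minimal2[of "{z. x < z \<and> z \<le> y}" y] by auto
      have "covered_by x z"
        unfolding covered_by_def using z min by (metis (mono_tags, lifting) leD less_imp_le mem_Collect_eq order.trans)
      then have "hasse_adjacent x z" by (simp add: hasse_adjacent_def)
      moreover have "{w. z \<le> w \<and> w \<le> y} \<subset> {w. x \<le> w \<and> w \<le> y}"
        using z less(2) by (auto dest: leD)
      then have "card {w. z \<le> w \<and> w \<le> y} < card {w. x \<le> w \<and> w \<le> y}"
        by (intro psubset_card_mono) auto
      then have "y \<in> hasse_component z" using less(1) z(2) by blast
      ultimately show ?thesis
        unfolding hasse_component_def by (auto intro: converse_rtranclp_into_rtranclp)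
    qed (simp add: self_in_hasse_component)
  qed
  then show ?thesis by (rule hasse_component_eq[symmetric])
qed

lemma hasse_adjacent_comparable: "hasse_adjacent x y \<Longrightarrow> x \<le> y \<or> y \<le> x"
  by (auto simp: hasse_adjacent_def covered_by_def)

lemma mono_image_hasse_component:
  fixes \<phi> :: "'p::{finite,order} \<Rightarrow> 'q::{finite,order}"
  assumes "mono \<phi>"
  shows "\<phi> ` hasse_component x \<subseteq> hasse_component (\<phi> x)"
proof -
  have eq: "hasse_component (\<phi> y) = hasse_component (\<phi> x)" if "hasse_adjacent\<^sup>*\<^sup>* x y" for y
    using that
  proof (induction rule: rtranclp_induct)
    case (step y z)
    then show ?case
      using hasse_adjacent_comparable[OF step(2)] monoD[OF assms] le_imp_hasse_component_eq by metis
  qed simp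
  show ?thesis
  proof (rule image_subsetI)
    fix y assume "y \<in> hasse_component x"
    then have "hasse_adjacent\<^sup>*\<^sup>* x y" by (simp add: hasse_component_def)
    then have "hasse_component (\<phi> y) = hasse_component (\<phi> x)" by (rule eq)
    then show "\<phi> y \<in> hasse_component (\<phi> x)" using self_in_hasse_component by blast
  qed
qed

text \<open>Comparable elements share a component, so choosing one map per component, as opposed to
  one per point, keeps the glued map monotone.\<close>

lemma glue_components:
  fixes Q :: "'p::{finite,order} \<Rightarrow> 'q::order \<Rightarrow> bool"
  assumes "\<And>x. \<exists>\<phi>. mono_on (hasse_component x) \<phi> \<and> (\<forall>z\<in>hasse_component x. Q z (\<phi> z))"
  shows "\<exists>\<phi>. mono \<phi> \<and> (\<forall>z. Q z (\<phi> z))"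
proof -
  have "\<forall>A\<in>range hasse_component. \<exists>\<phi>. mono_on A \<phi> \<and> (\<forall>z\<in>A. Q z (\<phi> z))"
    using assms by blast
  then obtain \<Phi> where \<Phi>: "\<And>x. mono_on (hasse_component x) (\<Phi> (hasse_component x)) \<and>
      (\<forall>z\<in>hasse_component x. Q z (\<Phi> (hasse_component x) z))"
    unfolding bchoice_iff by blast
  define \<phi> where "\<phi> x = \<Phi> (hasse_component x) x" for x
  have "mono \<phi>"
  proof (rule monoI)
    fix x y :: 'p assume "x \<le> y"
    then have "hasse_component y = hasse_component x" using le_imp_hasse_component_eq by metis
    then show "\<phi> x \<le> \<phi> y"
      unfolding \<phi>_def using \<Phi>[of x] \<open>x \<le> y\<close> self_in_hasse_component by (metis mono_onD)
  qed
  moreover have "Q z (\<phi> z)" for z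
    unfolding \<phi>_def using \<Phi>[of z] self_in_hasse_component by blast
  ultimately show ?thesis by blast
qed

text \<open>The cone over a root \<open>r\<close> is closed under adjacency: an
  \<open>R\<close>-predecessor of a member is comparable with \<open>r\<close> by the forest
  property, hence again in the cone. \<open>cmp\<close> lets \<open>R\<close> be the order or its
  dual.\<close>

lemma hasse_component_cone:
  fixes R :: "'p::{finite,order} \<Rightarrow> 'p \<Rightarrow> bool"
  assumes R: "forest R" and cmp: "\<And>x y. R x y \<or> R y x \<longleftrightarrow> x \<le> y \<or> y \<le> x"
    and r: "R r x" "\<And>w. R w r \<Longrightarrow> w = r"
  shows "hasse_component x = {z. R r z}"
proof -
  have R': "reflp R" "transp R" "\<And>x y z. R x z \<Longrightarrow> R y z \<Longrightarrow> R x y \<or> R y x"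
    using R unfolding forest_def by blast+
  have eq: "hasse_component r = hasse_component z" if "R r z" for z
    using cmp that le_imp_hasse_component_eq by metis
  have "R r z" if "hasse_adjacent\<^sup>*\<^sup>* r z" for z
    using that
  proof (induction rule: rtranclp_induct)
    case base
    show ?case using R'(1) by (rule reflpD)
  next
    case (step y z)
    then have "R y z \<or> R z y" using hasse_adjacent_comparable cmp by blast
    then show ?case using step R'(2,3) r(2) by (metis transpD)
  qed
  then have "hasse_component r = {z. R r z}"
    using eq self_in_hasse_component[where 'a = 'p] unfolding hasse_component_def[of r]
    by (metis (no_types, lifting) Collect_cong hasse_component_def mem_Collect_eq)
  then show ?thesis using eq[OF r(1)] by simp
qed

lemma hasse_component_rooted:
  fixes x :: "'p::{finite,order}"
  assumes "rooted TYPE('p)"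
  obtains r where "hasse_component x = {z. r \<le> z}"
proof -
  obtain r where r: "r \<le> x" "\<forall>b\<in>{z. z \<le> x}. b \<le> r \<longrightarrow> r = b"
    using finite_has_minimal2[of "{z. z \<le> x}" x] by auto
  have "hasse_component x = {z. r \<le> z}"
    by (rule hasse_component_cone) (use r assms forest_le_iff_rooted in \<open>auto dest: order.trans\<close>)
  then show ?thesis by (rule that)
qed

lemma hasse_component_co_rooted:
  fixes x :: "'p::{finite,order}"
  assumes "co_rooted TYPE('p)"
  obtains r where "hasse_component x = {z. z \<le> r}"
proof -
  obtain r where r: "x \<le> r" "\<forall>b\<in>{z. x \<le> z}. r \<le> b \<longrightarrow> r = b"
    using finite_has_maximal2[of "{z. x \<le> z}" x] by auto
  have "hasse_component x = {z. z \<le> r}"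
    by (rule hasse_component_cone[where R = "(\<ge>)"])
      (use r assms forest_ge_iff_co_rooted in \<open>auto dest: order.trans\<close>)
  then show ?thesis by (rule that)
qed

text \<open>Rootedness gives each component a least element, and co-rootedness makes any two
  elements above it comparable.\<close>

lemma rooted_co_rooted_imp_chains:
  assumes "rooted TYPE('p::{finite,order})" and "co_rooted TYPE('p)"
  shows "disjoint_union_of_chains TYPE('p)"
  unfolding disjoint_union_of_chains_def
proof (intro allI ballI)
  fix x y z :: 'p assume xy: "x \<in> hasse_component z" "y \<in> hasse_component z"
  obtain r where "hasse_component z = {z. r \<le> z}"
    using hasse_component_rooted[OF assms(1)] .
  then have "r \<le> x" "r \<le> y" using xy by auto
  then show "x \<le> y \<or> y \<le> x"
    using assms(2) unfolding forest_ge_iff_co_rooted[symmetric] forest_def by blast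
qed

section \<open>Covers of the graphs of order-preserving maps\<close>

definition hom_graphs :: "('p::order \<times> 'q::order) set set" where
  "hom_graphs = {range (\<lambda>x. (x, \<phi> x)) | \<phi>. mono \<phi>}"

definition transposed_graph :: "('q \<Rightarrow> 'p) \<Rightarrow> ('p \<times> 'q) set" where
  "transposed_graph \<psi> = range (\<lambda>y. (\<psi> y, y))"

lemma hom_ideal_eq_edge_ideal:
  "hom_ideal TYPE('p::{finite,order}) TYPE('q::{finite,order}) TYPE('k::field) = edge_ideal hom_graphs"
proof -
  have "hom_monomial \<phi> = (\<Prod>v\<in>range (\<lambda>x. (x, \<phi> x)). var v :: ('p \<times> 'q, 'k) mpoly)" for \<phi> :: "'p \<Rightarrow> 'q"
    by (simp add: hom_monomial_def prod.reindex inj_on_def)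
  then have "{hom_monomial \<phi> | \<phi> :: 'p \<Rightarrow> 'q. mono \<phi>} =
      (\<lambda>E. \<Prod>v\<in>E. var v :: ('p \<times> 'q, 'k) mpoly) ` hom_graphs"
    unfolding hom_graphs_def by auto
  then show ?thesis by (simp add: hom_ideal_def edge_ideal_def)
qed

lemma vertex_cover_hom_graphs:
  "vertex_cover hom_graphs C \<longleftrightarrow> (\<forall>\<phi>. mono \<phi> \<longrightarrow> (\<exists>x. (x, \<phi> x) \<in> C))"
  by (auto simp: vertex_cover_def hom_graphs_def)

lemma card_transposed_graph: "card (transposed_graph (\<psi> :: 'q::finite \<Rightarrow> 'p)) = card (UNIV :: 'q set)"
  unfolding transposed_graph_def by (rule card_image) (simp add: inj_on_def)

text \<open>Constant maps are monotone, so a cover has a point over every \<open>y\<close>.\<close>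

lemma cover_contains_transposed_graph:
  fixes C :: "('p::order \<times> 'q::order) set"
  assumes "vertex_cover hom_graphs C"
  obtains \<psi> where "transposed_graph \<psi> \<subseteq> C"
proof -
  have "\<exists>x. (x, y) \<in> C" for y
    using assms[unfolded vertex_cover_hom_graphs, rule_format, of "\<lambda>_. y"] by (simp add: mono_def)
  then obtain \<psi> where "\<And>y. (\<psi> y, y) \<in> C" by metis
  then have "transposed_graph \<psi> \<subseteq> C" by (auto simp: transposed_graph_def)
  then show ?thesis by (rule that)
qed

text \<open>A smaller cover would again contain a transposed graph, and all of these have the same
  cardinality.\<close>

lemma minimal_cover_transposed_graph:
  fixes \<psi> :: "'q::{finite,order} \<Rightarrow> 'p::{finite,order}"
  assumes "vertex_cover hom_graphs (transposed_graph \<psi>)"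
  shows "minimal_cover hom_graphs (transposed_graph \<psi>)"
  unfolding minimal_cover_def
proof (intro conjI allI impI assms)
  fix D assume D: "vertex_cover hom_graphs D" "D \<subseteq> transposed_graph \<psi>"
  obtain \<chi> where \<chi>: "transposed_graph \<chi> \<subseteq> D"
    using cover_contains_transposed_graph[OF D(1)] .
  then have "transposed_graph \<chi> = transposed_graph \<psi>"
    using D(2) by (intro card_subset_eq) (auto simp: card_transposed_graph)
  with \<chi> D(2) show "D = transposed_graph \<psi>" by blast
qed

lemma unmixed_hom_ideal_iff:
  "unmixed ring_of_type_algebra (hom_ideal TYPE('p::{finite,order}) TYPE('q::{finite,order}) TYPE('k::field)) \<longleftrightarrow>
    (\<forall>C :: ('p \<times> 'q) set. minimal_cover hom_graphs C \<longrightarrow> card C = card (UNIV :: 'q set))"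
proof -
  \<comment> \<open>\<open>undefined\<close> is an arbitrary point \<open>p\<close>; the cover
    \<open>{p} \<times> Q\<close> fixes the common cardinality.\<close>
  have "vertex_cover hom_graphs (transposed_graph (\<lambda>_ :: 'q. undefined :: 'p))"
    by (auto simp: vertex_cover_hom_graphs transposed_graph_def)
  then have "minimal_cover hom_graphs (transposed_graph (\<lambda>_ :: 'q. undefined :: 'p))"
    by (rule minimal_cover_transposed_graph)
  then show ?thesis
    unfolding hom_ideal_eq_edge_ideal unmixed_edge_ideal_iff
    using card_transposed_graph by metis
qed

text \<open>
  A map avoiding the first two parts of \<open>C\<close> sends \<open>p1\<close> above \<open>q2\<close> and \<open>p2\<close> above \<open>q1\<close>, hence \<open>p\<close>
  above both.  Conversely, \<open>\<psi>\<close> is forced at \<open>q1\<close> and \<open>q2\<close>, and a map with only two values escapes it.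
\<close>

lemma mixed_fork_cover:
  fixes R :: "'a \<Rightarrow> 'a \<Rightarrow> bool" and S :: "'b \<Rightarrow> 'b \<Rightarrow> bool"
  assumes R: "reflp R" "transp R" and S: "reflp S" "transp S"
    and p: "R p1 p" "R p2 p" "\<not> R p1 p2" "\<not> R p2 p1"
    and q: "S q q1" "S q q2" "\<not> S q1 q2" "\<not> S q2 q1"
  obtains C where "\<And>\<phi>. monotone R S \<phi> \<Longrightarrow> \<exists>x. (x, \<phi> x) \<in> C"
    and "\<And>\<psi>. (\<And>y. (\<psi> y, y) \<in> C) \<Longrightarrow> \<exists>\<phi>. monotone R S \<phi> \<and> (\<forall>x. \<psi> (\<phi> x) \<noteq> x)"
proof
  define C where "C = {(p1, y) | y. \<not> S q2 y} \<union> {(p2, y) | y. \<not> S q1 y} \<union> {(p, y) | y. S q1 y \<and> S q2 y}"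
  show "\<exists>x. (x, \<phi> x) \<in> C" if "monotone R S \<phi>" for \<phi>
  proof (rule ccontr)
    assume no: "\<not> ?thesis"
    then have "S q2 (\<phi> p1)" "S q1 (\<phi> p2)" by (auto simp: C_def)
    then have "S q2 (\<phi> p)" "S q1 (\<phi> p)"
      using monotoneD[OF that] p(1,2) transpD[OF S(2)] by blast+
    with no show False by (auto simp: C_def)
  qed
  have step: "monotone R S (\<lambda>x. if R a x then d else q)" if "S q d" for a d
    using that transpD[OF R(2)] reflpD[OF S(1)] by (intro monotoneI) auto
  show "\<exists>\<phi>. monotone R S \<phi> \<and> (\<forall>x. \<psi> (\<phi> x) \<noteq> x)" if \<psi>: "\<And>y. (\<psi> y, y) \<in> C" for \<psi>
  proof -
    have 1: "\<psi> q1 = p1" and 2: "\<psi> q2 = p2"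
      using \<psi>[of q1] \<psi>[of q2] q(3,4) reflpD[OF S(1)] by (auto simp: C_def)
    have "\<not> S q1 q" using q(2,3) transpD[OF S(2)] by blast
    \<comment> \<open>The third part of \<open>C\<close> is excluded at \<open>q\<close>, which is
      not above \<open>q1\<close>.\<close>
    then have "\<psi> q = p1 \<or> \<psi> q = p2"
      using \<psi>[of q] by (auto simp: C_def)
    then show ?thesis
    proof
      \<comment> \<open>The escaping map takes \<open>q2\<close> on the cone over \<open>p1\<close>
        and \<open>q\<close> elsewhere. \<open>\<psi>\<close> sends \<open>q2\<close> to
        \<open>p2\<close>, outside that cone, and \<open>q\<close> to \<open>p1\<close>, inside
        it.\<close>
      assume "\<psi> q = p1"
      then show ?thesis
        using step[OF q(2), of p1] 2 p(3) reflpD[OF R(1), of p1]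
        by (intro exI[of _ "\<lambda>x. if R p1 x then q2 else q"]) auto
    next
      assume "\<psi> q = p2"
      then show ?thesis
        using step[OF q(1), of p2] 1 p(4) reflpD[OF R(1), of p2]
        by (intro exI[of _ "\<lambda>x. if R p2 x then q1 else q"]) auto
    qed
  qed
qed

text \<open>In the unmixed case a minimal cover inside \<open>C\<close> is too small to be more than
  a transposed graph of some \<open>\<psi>\<close>, and the second assumption gives a map avoiding
  it.\<close>

lemma not_unmixed_of_cover:
  fixes C :: "('p::{finite,order} \<times> 'q::{finite,order}) set"
  assumes "\<And>\<phi>. mono \<phi> \<Longrightarrow> \<exists>x. (x, \<phi> x) \<in> C"
    and "\<And>\<psi>. (\<And>y. (\<psi> y, y) \<in> C) \<Longrightarrow> \<exists>\<phi>. mono \<phi> \<and> (\<forall>x. \<psi> (\<phi> x) \<noteq> x)"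
  shows "\<not> unmixed ring_of_type_algebra (hom_ideal TYPE('p) TYPE('q) TYPE('k::field))"
proof
  assume unmixed: "unmixed ring_of_type_algebra (hom_ideal TYPE('p) TYPE('q) TYPE('k))"
  have "vertex_cover hom_graphs C" using assms(1) by (simp add: vertex_cover_hom_graphs)
  then obtain D where D: "minimal_cover hom_graphs D" "D \<subseteq> C"
    by (rule vertex_cover_contains_minimal)
  then have cover: "vertex_cover hom_graphs D" by (simp add: minimal_cover_def)
  then obtain \<psi> where \<psi>: "transposed_graph \<psi> \<subseteq> D" by (rule cover_contains_transposed_graph)
  have "card D = card (UNIV :: 'q set)"
    using unmixed D(1) by (simp add: unmixed_hom_ideal_iff)
  with \<psi> have eq: "transposed_graph \<psi> = D"
    by (intro card_subset_eq) (auto simp: card_transposed_graph)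
  have "(\<psi> y, y) \<in> C" for y
    using D(2) by (auto simp: eq[symmetric] transposed_graph_def)
  then obtain \<phi> where "mono \<phi>" "\<And>x. \<psi> (\<phi> x) \<noteq> x" using assms(2) by blast
  then have "(x, \<phi> x) \<notin> D" for x
    by (auto simp: eq[symmetric] transposed_graph_def) metis
  with cover \<open>mono \<phi>\<close> show False unfolding vertex_cover_hom_graphs by blast
qed

text \<open>The second case is the first one for the dual orders, which have the same monotone
  maps.\<close>

lemma not_unmixed_of_forks:
  assumes "\<not> rooted TYPE('p::{finite,order}) \<and> \<not> co_rooted TYPE('q::{finite,order}) \<or>
    \<not> co_rooted TYPE('p) \<and> \<not> rooted TYPE('q)"
  shows "\<not> unmixed ring_of_type_algebra (hom_ideal TYPE('p) TYPE('q) TYPE('k::field))"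
  using assms
proof
  assume *: "\<not> rooted TYPE('p) \<and> \<not> co_rooted TYPE('q)"
  then obtain p1 p2 p :: 'p where p: "p1 \<le> p" "p2 \<le> p" "\<not> p1 \<le> p2" "\<not> p2 \<le> p1"
    unfolding rooted_def incomparable_def by (auto dest: less_imp_le)
  obtain q1 q2 q :: 'q where q: "q \<le> q1" "q \<le> q2" "\<not> q1 \<le> q2" "\<not> q2 \<le> q1"
    using * unfolding co_rooted_def incomparable_def by (auto dest: less_imp_le)
  obtain C :: "('p \<times> 'q) set" where
    "\<And>\<phi>. mono \<phi> \<Longrightarrow> \<exists>x. (x, \<phi> x) \<in> C"
    "\<And>\<psi>. (\<And>y. (\<psi> y, y) \<in> C) \<Longrightarrow> \<exists>\<phi>. mono \<phi> \<and> (\<forall>x. \<psi> (\<phi> x) \<noteq> x)"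
    by (rule mixed_fork_cover[of "(\<le>)" "(\<le>)", OF _ _ _ _ p q]) auto
  then show ?thesis by (rule not_unmixed_of_cover)
next
  assume *: "\<not> co_rooted TYPE('p) \<and> \<not> rooted TYPE('q)"
  then obtain p1 p2 p :: 'p where p: "p1 \<ge> p" "p2 \<ge> p" "\<not> p1 \<ge> p2" "\<not> p2 \<ge> p1"
    unfolding co_rooted_def incomparable_def by (auto dest: less_imp_le)
  obtain q1 q2 q :: 'q where q: "q \<ge> q1" "q \<ge> q2" "\<not> q1 \<ge> q2" "\<not> q2 \<ge> q1"
    using * unfolding rooted_def incomparable_def by (auto dest: less_imp_le)
  have refl_trans: "reflp ((\<ge>) :: 'p \<Rightarrow> _)" "transp ((\<ge>) :: 'p \<Rightarrow> _)"
      "reflp ((\<ge>) :: 'q \<Rightarrow> _)" "transp ((\<ge>) :: 'q \<Rightarrow> _)"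
    by (auto intro: reflpI transpI)
  obtain C :: "('p \<times> 'q) set" where
    "\<And>\<phi>. monotone (\<ge>) (\<ge>) \<phi> \<Longrightarrow> \<exists>x. (x, \<phi> x) \<in> C"
    "\<And>\<psi>. (\<And>y. (\<psi> y, y) \<in> C) \<Longrightarrow> \<exists>\<phi>. monotone (\<ge>) (\<ge>) \<phi> \<and> (\<forall>x. \<psi> (\<phi> x) \<noteq> x)"
    by (rule mixed_fork_cover[of "(\<ge>)" "(\<ge>)", OF refl_trans p q]) blast
  then show ?thesis unfolding monotone_on_dual by (rule not_unmixed_of_cover)
qed

text \<open>If every component of \<open>P\<close> failed for some component of \<open>Q\<close>,
  the dichotomy would give maps avoiding \<open>C\<close> on all components of \<open>P\<close>, and
  these would glue. So one component of \<open>P\<close> works for all of \<open>Q\<close>.\<close>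

lemma cover_contains_monotone_graph:
  fixes C :: "('p::{finite,order} \<times> 'q::{finite,order}) set"
  assumes dich: "\<And>(x :: 'p) (y :: 'q). dichotomy (hasse_component x) (hasse_component y)"
    and cover: "vertex_cover hom_graphs C"
  obtains \<psi> x where "mono \<psi>" and "range \<psi> \<subseteq> hasse_component x" and "transposed_graph \<psi> \<subseteq> C"
proof -
  have "\<exists>x. \<forall>y. \<exists>\<psi>. mono_on (hasse_component y) \<psi> \<and>
      (\<forall>z\<in>hasse_component y. \<psi> z \<in> hasse_component x \<and> (\<psi> z, z) \<in> C)"
  proof (rule ccontr)
    assume no: "\<not> ?thesis"
    have "\<exists>\<phi>. mono_on (hasse_component x) \<phi> \<and> (\<forall>z\<in>hasse_component x. (z, \<phi> z) \<notin> C)" for x :: 'p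
    proof -
      obtain y :: 'q where "\<not> (\<exists>\<psi>. mono_on (hasse_component y) \<psi> \<and>
          (\<forall>z\<in>hasse_component y. \<psi> z \<in> hasse_component x \<and> (\<psi> z, z) \<in> C))"
        using no by blast
      with spec[OF dich[of x y, unfolded dichotomy_def], of "\<lambda>x y. (x, y) \<notin> C"]
      show ?thesis by blast
    qed
    then have "\<exists>\<phi>. mono \<phi> \<and> (\<forall>z. (z, \<phi> z) \<notin> C)" by (rule glue_components)
    with cover show False by (auto simp: vertex_cover_hom_graphs)
  qed
  then obtain x where "\<And>y. \<exists>\<psi>. mono_on (hasse_component y) \<psi> \<and>
      (\<forall>z\<in>hasse_component y. \<psi> z \<in> hasse_component x \<and> (\<psi> z, z) \<in> C)" by blast
  then have "\<exists>\<psi>. mono \<psi> \<and> (\<forall>z. \<psi> z \<in> hasse_component x \<and> (\<psi> z, z) \<in> C)"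
    by (rule glue_components)
  then show ?thesis using that by (auto simp: transposed_graph_def image_subset_iff)
qed

text \<open>\<open>\<phi>\<close> sends the component of \<open>x\<close> into a single component
  and \<open>\<psi>\<close> leads back, so the composite has a fixed point \<open>z\<close>, and
  \<open>(z, \<phi> z)\<close> lies on both graphs.\<close>

lemma monotone_graph_is_cover:
  fixes \<psi> :: "'q::{finite,order} \<Rightarrow> 'p::{finite,order}"
  assumes fp: "\<And>(x :: 'p) (y :: 'q). fixpoint_property (hasse_component x) \<or> fixpoint_property (hasse_component y)"
    and \<psi>: "mono \<psi>" "range \<psi> \<subseteq> hasse_component x"
  shows "vertex_cover hom_graphs (transposed_graph \<psi>)"
  unfolding vertex_cover_hom_graphs
proof (intro allI impI)
  fix \<phi> :: "'p \<Rightarrow> 'q" assume \<phi>: "mono \<phi>"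
  have "\<exists>z\<in>hasse_component x. \<psi> (\<phi> z) = z"
  proof (rule fixpoint_property_comp[OF fp[of x "\<phi> x"]])
    show "\<phi> ` hasse_component x \<subseteq> hasse_component (\<phi> x)"
      using \<phi> by (rule mono_image_hasse_component)
  qed (use \<phi> \<psi> in \<open>auto intro: mono_on_subset\<close>)
  then obtain z where "\<psi> (\<phi> z) = z" by blast
  then have "(z, \<phi> z) \<in> transposed_graph \<psi>"
    unfolding transposed_graph_def by (intro image_eqI[of _ _ "\<phi> z"]) simp_all
  then show "\<exists>z. (z, \<phi> z) \<in> transposed_graph \<psi>" by blast
qed

section \<open>Classification of the minimal covers and of the unmixed ideals\<close>

definition paired_condition :: "'p::order itself \<Rightarrow> 'q::order itself \<Rightarrow> bool" where
  "paired_condition (P :: 'p itself) (Q :: 'q itself) \<longleftrightarrow>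
    rooted P \<and> rooted Q \<or> co_rooted P \<and> co_rooted Q \<or>
    disjoint_union_of_chains P \<or> disjoint_union_of_chains Q"

text \<open>In the rooted and co-rooted cases the components are cones, otherwise one of the two is
  a chain.\<close>

lemma components_of_paired_condition:
  fixes x :: "'p::{finite,order}" and y :: "'q::{finite,order}"
  assumes "paired_condition TYPE('p) TYPE('q)"
  shows "dichotomy (hasse_component x) (hasse_component y) \<and>
    (fixpoint_property (hasse_component x) \<or> fixpoint_property (hasse_component y))"
proof -
  consider (rooted) "rooted TYPE('p)" "rooted TYPE('q)"
    | (co_rooted) "co_rooted TYPE('p)" "co_rooted TYPE('q)"
    | (left) "disjoint_union_of_chains TYPE('p)" | (right) "disjoint_union_of_chains TYPE('q)"
    using assms unfolding paired_condition_def by blast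
  then show ?thesis
  proof cases
    case rooted
    obtain r where r: "hasse_component x = {z. r \<le> z}"
      using hasse_component_rooted[OF rooted(1)] .
    obtain s where s: "hasse_component y = {z. s \<le> z}"
      using hasse_component_rooted[OF rooted(2)] .
    have "fixpoint_property {z. r \<le> z}" by (rule fixpoint_propertyI[of r]) auto
    with rooted show ?thesis
      unfolding r s by (simp add: dichotomy_forest forest_le_iff_rooted)
  next
    case co_rooted
    obtain r where r: "hasse_component x = {z. z \<le> r}"
      using hasse_component_co_rooted[OF co_rooted(1)] .
    obtain s where s: "hasse_component y = {z. z \<le> s}"
      using hasse_component_co_rooted[OF co_rooted(2)] .
    have "fixpoint_property {z. z \<le> r}" by (rule fixpoint_propertyI[of r]) auto
    with co_rooted show ?thesis
      unfolding r s by (simp add: dichotomy_dual_forest forest_ge_iff_co_rooted)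
  next
    case left
    then have "\<forall>u\<in>hasse_component x. \<forall>v\<in>hasse_component x. u \<le> v \<or> v \<le> u"
      by (simp add: disjoint_union_of_chains_def)
    then have "dichotomy (hasse_component x) (hasse_component y)"
      and "fixpoint_property (hasse_component x)"
      using dichotomy_chain fixpoint_propertyI[OF self_in_hasse_component[of x]]
        self_in_hasse_component[of x] by blast+
    then show ?thesis by blast
  next
    case right
    then have "\<forall>u\<in>hasse_component y. \<forall>v\<in>hasse_component y. u \<le> v \<or> v \<le> u"
      by (simp add: disjoint_union_of_chains_def)
    then have "dichotomy (hasse_component y) (hasse_component x)"
      and "fixpoint_property (hasse_component y)"
      using dichotomy_chain fixpoint_propertyI[OF self_in_hasse_component[of y]]
        self_in_hasse_component[of y] by blast+
    then show ?thesis using dichotomy_sym by blast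
  qed
qed

text \<open>Confinement to one component matters: for two-point antichains, the identity as
  \<open>\<psi>\<close> gives no cover, since the transposition avoids it.\<close>

lemma minimal_cover_hom_graphs_iff:
  fixes C :: "('p::{finite,order} \<times> 'q::{finite,order}) set"
  assumes "paired_condition TYPE('p) TYPE('q)"
  shows "minimal_cover hom_graphs C \<longleftrightarrow>
    (\<exists>\<psi> x. mono \<psi> \<and> range \<psi> \<subseteq> hasse_component x \<and> C = transposed_graph \<psi>)"
proof
  assume C: "minimal_cover hom_graphs C"
  then have "vertex_cover hom_graphs C" by (simp add: minimal_cover_def)
  then obtain \<psi> x where \<psi>: "mono \<psi>" "range \<psi> \<subseteq> hasse_component x" "transposed_graph \<psi> \<subseteq> C"
    using cover_contains_monotone_graph components_of_paired_condition[OF assms] by metis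
  then have "vertex_cover hom_graphs (transposed_graph \<psi>)"
    using monotone_graph_is_cover components_of_paired_condition[OF assms] by blast
  then have "transposed_graph \<psi> = C"
    using C \<psi>(3) by (simp add: minimal_cover_def)
  with \<psi>(1,2) show "\<exists>\<psi> x. mono \<psi> \<and> range \<psi> \<subseteq> hasse_component x \<and> C = transposed_graph \<psi>"
    by blast
next
  assume "\<exists>\<psi> x. mono \<psi> \<and> range \<psi> \<subseteq> hasse_component x \<and> C = transposed_graph \<psi>"
  then show "minimal_cover hom_graphs C"
    using monotone_graph_is_cover components_of_paired_condition[OF assms]
      minimal_cover_transposed_graph by blast
qed

text \<open>Excluding both pairs of forks leaves four cases: both posets rooted, both co-rooted, or
  one of them rooted and co-rooted at once.\<close>

lemma unmixed_hom_ideal_iff_paired_condition: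
  "unmixed ring_of_type_algebra (hom_ideal TYPE('p::{finite,order}) TYPE('q::{finite,order}) TYPE('k::field)) \<longleftrightarrow>
    paired_condition TYPE('p) TYPE('q)"
proof
  assume "unmixed ring_of_type_algebra (hom_ideal TYPE('p) TYPE('q) TYPE('k))"
  then have "\<not> (\<not> rooted TYPE('p) \<and> \<not> co_rooted TYPE('q) \<or> \<not> co_rooted TYPE('p) \<and> \<not> rooted TYPE('q))"
    using not_unmixed_of_forks by blast
  then show "paired_condition TYPE('p) TYPE('q)"
    unfolding paired_condition_def
    using rooted_co_rooted_imp_chains[where 'p = 'p] rooted_co_rooted_imp_chains[where 'p = 'q] by blast
next
  assume "paired_condition TYPE('p) TYPE('q)"
  then show "unmixed ring_of_type_algebra (hom_ideal TYPE('p) TYPE('q) TYPE('k))"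
    unfolding unmixed_hom_ideal_iff by (auto simp: minimal_cover_hom_graphs_iff card_transposed_graph)
qed

text \<open>Any point can stand for \<open>undefined\<close>: a connected source has its image in
  one component, and a connected target has only one.\<close>

lemma range_subset_component_if_connected:
  fixes \<psi> :: "'q::{finite,order} \<Rightarrow> 'p::{finite,order}"
  assumes "connected_poset TYPE('p) \<or> connected_poset TYPE('q)" and "mono \<psi>"
  shows "range \<psi> \<subseteq> hasse_component (\<psi> undefined)"
  using assms(1)
proof
  assume "connected_poset TYPE('q)"
  then show ?thesis
    using mono_image_hasse_component[OF assms(2), of undefined] by (simp add: connected_poset_def)
qed (simp add: connected_poset_def)

lemma swap_hom_graphs:
  "(`) prod.swap ` (hom_graphs :: ('q::order \<times> 'p::order) set set) = {transposed_graph \<psi> | \<psi>. mono \<psi>}"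
proof -
  have "prod.swap ` range (\<lambda>y. (y, \<psi> y)) = transposed_graph \<psi>" for \<psi> :: "'q \<Rightarrow> 'p"
    by (simp add: transposed_graph_def image_image)
  then show ?thesis unfolding hom_graphs_def by (auto simp: image_iff) (metis)
qed

theorem proposition3p8:
  shows "(unmixed ring_of_type_algebra
            (hom_ideal TYPE('p::{finite,order}) TYPE('q::{finite,order}) TYPE('k::field)) \<longleftrightarrow>
          (rooted TYPE('p) \<and> rooted TYPE('q)) \<or>
          (co_rooted TYPE('p) \<and> co_rooted TYPE('q)) \<or>
          (disjoint_union_of_chains TYPE('p) \<or> disjoint_union_of_chains TYPE('q))) \<and>
         ((connected_poset TYPE('p) \<or> connected_poset TYPE('q)) \<and>
          unmixed ring_of_type_algebra (hom_ideal TYPE('p) TYPE('q) TYPE('k)) \<longrightarrow>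
          alexander_dual (hom_ideal TYPE('p) TYPE('q) TYPE('k)) =
            swap_indices ` hom_ideal TYPE('q) TYPE('p) TYPE('k))"
proof (intro conjI impI)
  show "unmixed ring_of_type_algebra (hom_ideal TYPE('p) TYPE('q) TYPE('k)) \<longleftrightarrow>
      (rooted TYPE('p) \<and> rooted TYPE('q)) \<or> (co_rooted TYPE('p) \<and> co_rooted TYPE('q)) \<or>
      (disjoint_union_of_chains TYPE('p) \<or> disjoint_union_of_chains TYPE('q))"
    unfolding unmixed_hom_ideal_iff_paired_condition paired_condition_def ..
next
  assume *: "(connected_poset TYPE('p) \<or> connected_poset TYPE('q)) \<and>
      unmixed ring_of_type_algebra (hom_ideal TYPE('p) TYPE('q) TYPE('k))"
  then have "paired_condition TYPE('p) TYPE('q)"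
    by (simp add: unmixed_hom_ideal_iff_paired_condition)
  note iff = minimal_cover_hom_graphs_iff[OF this]
  \<comment> \<open>With one poset connected, every monotone \<open>\<psi>\<close> stays in one
    component, so the minimal covers are exactly the swapped edges of
    \<open>hom_graphs\<close>.\<close>
  have "{C :: ('p \<times> 'q) set. minimal_cover hom_graphs C} = {transposed_graph \<psi> | \<psi>. mono \<psi>}"
    using range_subset_component_if_connected[OF conjunct1[OF *]] unfolding iff by blast
  then show "alexander_dual (hom_ideal TYPE('p) TYPE('q) TYPE('k)) =
      swap_indices ` hom_ideal TYPE('q) TYPE('p) TYPE('k)"
    by (simp add: hom_ideal_eq_edge_ideal alexander_dual_edge_ideal swap_indices_edge_ideal swap_hom_graphs)
qed

end
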